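(* For every $H\in(0,1)$, as $d\to\infty$, the $d$-dimensional Hermitian fractional Brownian motion $X^{(d)}$ of Hurst index $H$ converges, in the sense of non-commutative probability, to a non-commutative fractional Brownian motion $X^{(\infty)}$ of the same Hurst index $H$; that is, for every integer $r\ge1$ and all $t_1,\dots,t_r\ge0$, $$\varphi_d\big(X^{(d)}_{t_1}\cdots X^{(d)}_{t_r}\big)\xrightarrow[d\to\infty]{}\varphi_\infty\big(X^{(\infty)}_{t_1}\cdots X^{(\infty)}_{t_r}\big).$$
   Context: **Hermitian fractional Brownian motion.** Let $(x(i,j))_{i\ge j\ge1}$ and $(\tilde x(i,j))_{i\ge j\ge 1}$ be two independent families of independent fractional Brownian motions of Hurst index $H$ (centered Gaussian with covariance $c_H(s,t):=\frac12\{s^{2H}+t^{2H}-|t-s|^{2H}\}$). For $d\ge1$, $X^{(d)}$ is the process of $d\times d$ Hermitian matrices with $X^{(d)}_t(i,j)=\frac{1}{\sqrt{2d}}(x_t(i,j)+\imath\,\tilde x_t(i,j))$ for $j<i$, $X^{(d)}_t(i,i)=\frac1{\sqrt d}x_t(i,i)$, and $X^{(d)}_t(i,j)=\overline{X^{(d)}_t(j,i)}$ for $i<j$. **Trace.** For a $d\times d$ matrix $A$ with complex random entries having finite moments of all orders, $\varphi_d(A):=\frac1d\,\mathbb E\big[\sum_{i=1}^dA(i,i)\big]$. **Non-commutative probability space.** A pair $(\mathcal A,\varphi)$ where $\mathcal A$ is a unital complex $\ast$-algebra and $\varphi:\mathcal A\to\mathbb C$ is linear with $\varphi(1)=1$,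 $\varphi(XY)=\varphi(YX)$, $\varphi(X^\ast X)\ge0$. **Non-commutative fractional Brownian motion (NC-fBm) of Hurst index $H$.** In a non-commutative probability space $(\mathcal A^{(\infty)},\varphi_\infty)$, any collection $\{X^{(\infty)}_t\}_{t\ge0}$ of self-adjoint elements such that, for every even $r\ge 1$ and all $t_1,\dots,t_r\ge0$, $\varphi_\infty(X^{(\infty)}_{t_1}\cdots X^{(\infty)}_{t_r})=\sum_{\pi\in NC_2(r)}\prod_{\{p,q\}\in\pi}c_H(t_p,t_q)$, and $\varphi_\infty(X^{(\infty)}_{t_1}\cdots X^{(\infty)}_{t_r})=0$ for odd $r$. Here $NC_2(r)$ is the set of non-crossing pairings of $\{1,\dots,r\}$, i.e. partitions into two-element blocks with no $p<q<p'<q'$ such that $\{p,p'\}$ and $\{q,q'\}$ are blocks. Such a process exists for every $H\in(0,1)$. *)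

theory Defs
  imports "HOL-Probability.Probability" "Jordan_Normal_Form.Matrix"
begin

section \<open>Fractional Brownian motion\<close>

definition fbm_cov :: "real \<Rightarrow> real \<Rightarrow> real \<Rightarrow> real" where
  "fbm_cov H s t = (s powr (2 * H) + t powr (2 * H) - \<bar>t - s\<bar> powr (2 * H)) / 2"

context prob_space
begin

text \<open>
  \<^const>\<open>normal_density\<close> requires a positive standard deviation, so the constant (degenerate)
  Gaussian variables are added by hand: a fractional Brownian motion is degenerate at time 0.
\<close>
definition gaussian :: "('a \<Rightarrow> real) \<Rightarrow> bool" where
  "gaussian Y \<longleftrightarrow> random_variable borel Y \<and>
     ((\<exists>\<mu> \<sigma>. 0 < \<sigma> \<and> distributed M lborel Y (normal_density \<mu> \<sigma>)) \<or>
      (\<exists>\<mu>. AE \<omega> in M. Y \<omega> = \<mu>))"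

text \<open>Processes have time set \<^term>\<open>{0..} :: real set\<close>; values at negative times are irrelevant.\<close>
definition gaussian_process :: "(real \<Rightarrow> 'a \<Rightarrow> real) \<Rightarrow> bool" where
  "gaussian_process Y \<longleftrightarrow>
     (\<forall>J a. finite J \<and> J \<subseteq> {0..} \<longrightarrow> gaussian (\<lambda>\<omega>. \<Sum>t\<in>J. a t * Y t \<omega>))"

definition fractional_brownian_motion :: "real \<Rightarrow> (real \<Rightarrow> 'a \<Rightarrow> real) \<Rightarrow> bool" where
  "fractional_brownian_motion H Y \<longleftrightarrow>
     gaussian_process Y \<and>
     (\<forall>t\<ge>0. expectation (Y t) = 0) \<and>
     (\<forall>s\<ge>0. \<forall>t\<ge>0. expectation (\<lambda>\<omega>. Y s \<omega> * Y t \<omega>) = fbm_cov H s t)"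

end


section \<open>Hermitian fractional Brownian motion\<close>

text \<open>
  Matrices of \<^theory>\<open>Jordan_Normal_Form.Matrix\<close> have row and column indices starting from 0, hence
  the families \<open>x(i,j)\<close>, \<open>x'(i,j)\<close> are indexed by \<open>i \<ge> j \<ge> 0\<close>.
\<close>
definition lower_indices :: "(nat \<times> nat) set" where
  "lower_indices = {(i, j). j \<le> i}"

abbreviation path_space :: "(real \<Rightarrow> real) measure" where
  "path_space \<equiv> PiM {0..} (\<lambda>_. borel)"

definition sample_path :: "(real \<Rightarrow> 'w \<Rightarrow> real) \<Rightarrow> 'w \<Rightarrow> real \<Rightarrow> real" where
  "sample_path Y \<omega> = (\<lambda>t\<in>{0..}. Y t \<omega>)"

text \<open>All paths of a family jointly, as one random variable.\<close>
definition family_path ::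
  "(nat \<Rightarrow> nat \<Rightarrow> real \<Rightarrow> 'w \<Rightarrow> real) \<Rightarrow> 'w \<Rightarrow> nat \<times> nat \<Rightarrow> real \<Rightarrow> real" where
  "family_path x \<omega> = (\<lambda>(i, j)\<in>lower_indices. sample_path (x i j) \<omega>)"

context prob_space
begin

definition independent_fbm_family ::
  "real \<Rightarrow> (nat \<Rightarrow> nat \<Rightarrow> real \<Rightarrow> 'a \<Rightarrow> real) \<Rightarrow> bool" where
  "independent_fbm_family H x \<longleftrightarrow>
     (\<forall>(i, j)\<in>lower_indices. fractional_brownian_motion H (x i j)) \<and>
     indep_vars (\<lambda>_. path_space) (\<lambda>(i, j). sample_path (x i j)) lower_indices"

definition independent_families ::
  "(nat \<Rightarrow> nat \<Rightarrow> real \<Rightarrow> 'a \<Rightarrow> real) \<Rightarrow> (nat \<Rightarrow> nat \<Rightarrow> real \<Rightarrow> 'a \<Rightarrow> real) \<Rightarrow> bool" where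
  "independent_families x x' \<longleftrightarrow>
     indep_var (PiM lower_indices (\<lambda>_. path_space)) (family_path x)
               (PiM lower_indices (\<lambda>_. path_space)) (family_path x')"

end

definition hermitian_fbm ::
  "(nat \<Rightarrow> nat \<Rightarrow> real \<Rightarrow> 'w \<Rightarrow> real) \<Rightarrow> (nat \<Rightarrow> nat \<Rightarrow> real \<Rightarrow> 'w \<Rightarrow> real)
     \<Rightarrow> nat \<Rightarrow> real \<Rightarrow> 'w \<Rightarrow> complex mat" where
  "hermitian_fbm x x' d t \<omega> =
     (let lower = (\<lambda>i j. complex_of_real (1 / sqrt (2 * real d)) *
                         (complex_of_real (x i j t \<omega>) + \<i> * complex_of_real (x' i j t \<omega>)))
      in mat d d (\<lambda>(i, j).
           if j < i then lower i j
           else if i = j then complex_of_real (1 / sqrt (real d)) * complex_of_real (x i i t \<omega>)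
           else cnj (lower j i)))"

text \<open>The product \<open>A\<^sub>1 \<cdots> A\<^sub>r\<close> of a list of \<open>d \<times> d\<close> matrices.\<close>
definition mat_prod_list :: "nat \<Rightarrow> complex mat list \<Rightarrow> complex mat" where
  "mat_prod_list d As = foldr (*) As (1\<^sub>m d)"

text \<open>The functional \<open>\<phi>\<^sub>d\<close>, meant for random \<open>d \<times> d\<close> matrices whose entries have all moments.\<close>
definition (in prob_space) mean_trace :: "nat \<Rightarrow> ('a \<Rightarrow> complex mat) \<Rightarrow> complex" where
  "mean_trace d A = 1 / of_nat d * expectation (\<lambda>\<omega>. \<Sum>i<d. A \<omega> $$ (i, i))"


section \<open>Non-commutative probability spaces and fractional Brownian motion\<close>

text \<open>
  The unital algebra is the ring \<^typ>\<open>'a :: ring_1\<close> with scalar multiplication \<open>scale\<close> and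
  involution \<open>star\<close>. The class axiom \<open>0 \<noteq> 1\<close> is no restriction, as it follows from \<open>\<phi> 1 = 1\<close>.
\<close>
locale nc_probability_space =
  fixes scale :: "complex \<Rightarrow> 'a :: ring_1 \<Rightarrow> 'a"
    and star :: "'a \<Rightarrow> 'a"
    and \<phi> :: "'a \<Rightarrow> complex"
  assumes vector_space_scale: "vector_space scale"
    and scale_mult_left: "scale c a * b = scale c (a * b)"
    and scale_mult_right: "a * scale c b = scale c (a * b)"
    and star_star: "star (star a) = a"
    and star_add: "star (a + b) = star a + star b"
    and star_scale: "star (scale c a) = scale (cnj c) (star a)"
    and star_mult: "star (a * b) = star b * star a"
    and linear: "Vector_Spaces.linear scale (*) \<phi>"
    and unital: "\<phi> 1 = 1"
    and tracial: "\<phi> (a * b) = \<phi> (b * a)"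
    and positive: "\<phi> (star a * a) \<in> \<real>\<^sub>\<ge>\<^sub>0"

definition noncrossing_pairings :: "nat \<Rightarrow> nat set set set" where
  "noncrossing_pairings r =
     {\<pi>. partition_on {1..r} \<pi> \<and> (\<forall>b\<in>\<pi>. card b = 2) \<and>
         \<not> (\<exists>p q p' q'. p < q \<and> q < p' \<and> p' < q' \<and> {p, p'} \<in> \<pi> \<and> {q, q'} \<in> \<pi>)}"

text \<open>
  A block \<open>b = {p, q}\<close> contributes \<open>fbm_cov H (t p) (t q)\<close>; this is symmetric in \<open>p\<close> and \<open>q\<close>, so
  the choice \<open>p = Min b\<close>, \<open>q = Max b\<close> is immaterial.
\<close>
definition nc_fractional_brownian_motion ::
  "('a :: ring_1 \<Rightarrow> 'a) \<Rightarrow> ('a \<Rightarrow> complex) \<Rightarrow> real \<Rightarrow> (real \<Rightarrow> 'a) \<Rightarrow> bool" where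
  "nc_fractional_brownian_motion star \<phi> H X \<longleftrightarrow>
     (\<forall>t\<ge>0. star (X t) = X t) \<and>
     (\<forall>r\<ge>1. \<forall>t. (\<forall>k\<in>{1..r}. 0 \<le> t k) \<longrightarrow>
        \<phi> (prod_list (map (\<lambda>k. X (t k)) [1..<r + 1])) =
          (if even r
           then complex_of_real
                  (\<Sum>\<pi>\<in>noncrossing_pairings r. \<Prod>b\<in>\<pi>. fbm_cov H (t (Min b)) (t (Max b)))
           else 0))"

end

theory Submission
  imports Defs
begin

text \<open>
  The proof is the moment calculation for Gaussian matrices through Schwinger--Dyson equations.

  The entries of \<open>X\<^sup>(\<^sup>d\<^sup>)\<close> are jointly Gaussian and centered, with
  \<open>E[X\<^sub>s(i,j) X\<^sub>t(k,l)] = c\<^sub>H(s,t)/d\<close> if \<open>i = l\<close> and \<open>j = k\<close>, and \<open>0\<close> otherwise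
  (\<open>hermitian_gaussian_matrices_fbm\<close>). Gaussian integration by parts
  (\<open>expectation_wick_derivative\<close>) pairs a chosen entry with every other entry in an expectation.
  Applied to the first letter \<open>a\<close> of the first word in a mean product of traces of words, it gives an
  equation (\<open>schwinger_dyson\<close>) in which a partner \<open>b\<close> inside the same word \<open>a u b v\<close> splits its trace into
  the two traces of \<open>u\<close> and \<open>v\<close>, while a partner in another trace merges two traces into one.
  With every trace divided by \<open>d\<close>, a splitting has weight \<open>c(a,b)\<close> and a merging \<open>c(a,b)/d\<^sup>2\<close>
  (\<open>normalized_moment_rec\<close>).

  Both operations lower the total length of the words by two. Induction therefore shows that the mean of a product
  of normalized traces converges to a product of numbers \<open>L(w)\<close>, one for each word, where mergings
  have disappeared: \<open>L(a w) = \<Sum> c(a,b) L(u) L(v)\<close>, over all ways of writing \<open>w = u b v\<close>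
  (\<open>tendsto_free_moments\<close>). It is essential to treat products of several traces at once: this is
  what makes the induction close without a separate estimate of the variance of a trace.

  Sums over non-crossing pairings satisfy the same recursion: if the first point \<open>a\<close> is paired
  with \<open>k\<close>, no block can cross \<open>{a,k}\<close>, so the rest is a non-crossing pairing of the points
  between \<open>a\<close> and \<open>k\<close> together with one of the points after \<open>k\<close> (\<open>nc_sum_rec\<close>). Hence
  \<open>L(t\<^sub>1 \<dots> t\<^sub>r)\<close> is the corresponding moment of the non-commutative process.
\<close>


section \<open>Moments of Gaussian random variables\<close>

context prob_space
begin

text \<open>
  The class \<open>L\<^sup>p\<close> for all \<open>p < \<infinity>\<close>: an algebra which contains the Gaussian variables, so that
  polynomials in them are integrable by closure properties alone.
\<close>
definition all_moments :: "('a \<Rightarrow> 'b :: {banach, real_normed_algebra_1, second_countable_topology}) \<Rightarrow> bool" where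
  "all_moments f \<longleftrightarrow> random_variable borel f \<and> (\<forall>n. integrable M (\<lambda>\<omega>. norm (f \<omega>) ^ n))"

lemma all_moments_measurable: "all_moments f \<Longrightarrow> f \<in> borel_measurable M"
  by (simp add: all_moments_def)

lemma all_moments_integrable:
  assumes "all_moments f"
  shows "integrable M f"
proof -
  have "integrable M (\<lambda>\<omega>. norm (f \<omega>) ^ 1)"
    using assms unfolding all_moments_def by blast
  then have "integrable M (\<lambda>\<omega>. norm (f \<omega>))" by simp
  then show ?thesis
    using integrable_norm_iff[OF all_moments_measurable[OF assms]] by simp
qed

lemma all_moments_const: "all_moments (\<lambda>_. c)"
  by (simp add: all_moments_def)

lemma all_moments_add:
  assumes "all_moments f" "all_moments g"
  shows "all_moments (\<lambda>\<omega>. f \<omega> + g \<omega>)"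
  unfolding all_moments_def
proof (intro conjI allI)
  have [measurable]: "f \<in> borel_measurable M" "g \<in> borel_measurable M"
    using assms by (auto simp: all_moments_def)
  show "(\<lambda>\<omega>. f \<omega> + g \<omega>) \<in> borel_measurable M" by simp
  fix n
  show "integrable M (\<lambda>\<omega>. norm (f \<omega> + g \<omega>) ^ n)"
  proof (rule Bochner_Integration.integrable_bound)
    show "integrable M (\<lambda>\<omega>. 2 ^ n * (norm (f \<omega>) ^ n + norm (g \<omega>) ^ n))"
      using assms by (auto simp: all_moments_def)
    show "(\<lambda>\<omega>. norm (f \<omega> + g \<omega>) ^ n) \<in> borel_measurable M" by measurable
    have "norm (a + b) ^ n \<le> 2 ^ n * (norm a ^ n + norm b ^ n)" for a b :: 'b
    proof -
      define m where "m = max (norm a) (norm b)"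
      have "norm (a + b) \<le> 2 * m"
        using norm_triangle_ineq[of a b] by (simp add: m_def)
      then have "norm (a + b) ^ n \<le> (2 * m) ^ n" by (intro power_mono) auto
      also have "\<dots> = 2 ^ n * m ^ n" by (simp add: power_mult_distrib)
      also have "m ^ n \<le> norm a ^ n + norm b ^ n" by (auto simp: m_def max_def)
      finally show ?thesis by simp
    qed
    then show "AE \<omega> in M. norm (norm (f \<omega> + g \<omega>) ^ n)
        \<le> norm (2 ^ n * (norm (f \<omega>) ^ n + norm (g \<omega>) ^ n))"
      by simp
  qed
qed

lemma all_moments_mult:
  assumes "all_moments f" "all_moments g"
  shows "all_moments (\<lambda>\<omega>. f \<omega> * g \<omega>)"
  unfolding all_moments_def
proof (intro conjI allI)
  have [measurable]: "f \<in> borel_measurable M" "g \<in> borel_measurable M"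
    using assms by (auto simp: all_moments_def)
  show "(\<lambda>\<omega>. f \<omega> * g \<omega>) \<in> borel_measurable M" by simp
  fix n
  show "integrable M (\<lambda>\<omega>. norm (f \<omega> * g \<omega>) ^ n)"
  proof (rule Bochner_Integration.integrable_bound)
    show "integrable M (\<lambda>\<omega>. norm (f \<omega>) ^ (2 * n) + norm (g \<omega>) ^ (2 * n))"
      using assms by (auto simp: all_moments_def)
    show "(\<lambda>\<omega>. norm (f \<omega> * g \<omega>) ^ n) \<in> borel_measurable M" by measurable
    have "norm (a * b) ^ n \<le> norm a ^ (2 * n) + norm b ^ (2 * n)" for a b :: 'b
    proof -
      have "norm (a * b) ^ n \<le> (norm a * norm b) ^ n"
        by (intro power_mono norm_mult_ineq) auto
      also have "\<dots> = norm a ^ n * norm b ^ n" by (simp add: power_mult_distrib)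
      also have "\<dots> \<le> 2 * (norm a ^ n * norm b ^ n)" by simp
      also have "\<dots> \<le> (norm a ^ n)\<^sup>2 + (norm b ^ n)\<^sup>2"
        using sum_squares_bound[of "norm a ^ n" "norm b ^ n"] by (simp add: mult.assoc)
      finally show ?thesis by (simp add: power_mult[symmetric] mult.commute)
    qed
    then show "AE \<omega> in M. norm (norm (f \<omega> * g \<omega>) ^ n)
        \<le> norm (norm (f \<omega>) ^ (2 * n) + norm (g \<omega>) ^ (2 * n))"
      by simp
  qed
qed

lemma all_moments_power: "all_moments f \<Longrightarrow> all_moments (\<lambda>\<omega>. f \<omega> ^ n)"
  by (induction n) (auto intro: all_moments_mult all_moments_const)

lemma all_moments_of_real:
  assumes "all_moments f"
  shows "all_moments (\<lambda>\<omega>. complex_of_real (f \<omega>))"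
  unfolding all_moments_def
proof (intro conjI allI)
  have [measurable]: "f \<in> borel_measurable M" by (rule all_moments_measurable[OF assms])
  show "(\<lambda>\<omega>. complex_of_real (f \<omega>)) \<in> borel_measurable M" by measurable
  show "integrable M (\<lambda>\<omega>. norm (complex_of_real (f \<omega>)) ^ n)" for n
    using assms by (simp add: all_moments_def)
qed

lemma all_moments_sum:
  "(\<And>i. i \<in> I \<Longrightarrow> all_moments (f i)) \<Longrightarrow> all_moments (\<lambda>\<omega>. \<Sum>i\<in>I. f i \<omega>)"
  by (induction I rule: infinite_finite_induct) (auto intro: all_moments_add all_moments_const)

lemma all_moments_prod_list:
  "(\<And>h. h \<in> set hs \<Longrightarrow> all_moments h) \<Longrightarrow> all_moments (\<lambda>\<omega>. \<Prod>h\<leftarrow>hs. h \<omega>)"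
  by (induction hs) (auto intro: all_moments_mult all_moments_const)


text \<open>
  Centered Gaussian variables enter the proof only through this recursion for their moments. In contrast to
  \<^const>\<open>normal_density\<close> it covers the degenerate variable \<open>0\<close> without a case
  distinction, and it passes directly to sums of independent variables.
\<close>
definition gaussian_moments :: "('a \<Rightarrow> real) \<Rightarrow> bool" where
  "gaussian_moments Y \<longleftrightarrow> all_moments Y \<and> expectation Y = 0 \<and>
     (\<forall>n. expectation (\<lambda>\<omega>. Y \<omega> ^ (n + 2)) =
       real (n + 1) * expectation (\<lambda>\<omega>. Y \<omega> ^ 2) * expectation (\<lambda>\<omega>. Y \<omega> ^ n))"

lemma gaussian_moments_normal:
  assumes D: "distributed M lborel Y (normal_density 0 \<sigma>)" and \<sigma>: "0 < \<sigma>"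
  shows "gaussian_moments Y"
proof -
  have [measurable]: "Y \<in> borel_measurable M"
    using distributed_measurable[OF D] by simp
  have mom: "expectation (\<lambda>\<omega>. Y \<omega> ^ n) = (\<integral>x. normal_density 0 \<sigma> x * x ^ n \<partial>lborel)" for n
    by (rule distributed_integral[OF D, symmetric]) (auto simp: \<sigma>)
  have abs_mom: "integrable M (\<lambda>\<omega>. \<bar>Y \<omega>\<bar> ^ n)" for n
    using integrable_normal_moment_abs[OF \<sigma>, of 0 n]
      distributed_integrable[OF D, of "\<lambda>x. \<bar>x\<bar> ^ n"] by simp
  have odd: "expectation (\<lambda>\<omega>. Y \<omega> ^ (2 * k + 1)) = 0" for k
    using integral_normal_moment_odd[OF \<sigma>, of 0 k] by (simp only: mom diff_zero)
  have even: "expectation (\<lambda>\<omega>. Y \<omega> ^ (2 * k)) = fact (2 * k) / ((2 / \<sigma>\<^sup>2) ^ k * fact k)" for k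
    using integral_normal_moment_even[OF \<sigma>, of 0 k] by (simp only: mom diff_zero)
  have two: "expectation (\<lambda>\<omega>. Y \<omega> ^ 2) = \<sigma>\<^sup>2"
    using even[of 1] by simp
  have "expectation (\<lambda>\<omega>. Y \<omega> ^ (n + 2)) =
       real (n + 1) * expectation (\<lambda>\<omega>. Y \<omega> ^ 2) * expectation (\<lambda>\<omega>. Y \<omega> ^ n)" for n
  proof (cases "even n")
    case True
    then obtain k where k: "n = 2 * k" by (auto elim: evenE)
    have "expectation (\<lambda>\<omega>. Y \<omega> ^ (n + 2)) = fact (2 * Suc k) / ((2 / \<sigma>\<^sup>2) ^ Suc k * fact (Suc k))"
      using even[of "Suc k"] by (simp add: k)
    also have "\<dots> = real (n + 1) * \<sigma>\<^sup>2 * (fact (2 * k) / ((2 / \<sigma>\<^sup>2) ^ k * fact k))"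
      using \<sigma> by (simp add: k divide_simps)
    also have "\<dots> = real (n + 1) * expectation (\<lambda>\<omega>. Y \<omega> ^ 2) * expectation (\<lambda>\<omega>. Y \<omega> ^ n)"
      by (simp only: two even k)
    finally show ?thesis .
  next
    case False
    then obtain k where k: "n = 2 * k + 1" by (auto elim: oddE)
    have "n + 2 = 2 * (Suc k) + 1" by (simp add: k)
    then show ?thesis using odd[of "Suc k"] odd[of k] by (simp only: k) 
  qed
  then show ?thesis
    using odd[of 0] abs_mom by (auto simp: gaussian_moments_def all_moments_def)
qed

lemma gaussian_imp_gaussian_moments:
  assumes "gaussian Y" "expectation Y = 0"
  shows "gaussian_moments Y"
  using assms(1) unfolding gaussian_def
proof (elim conjE disjE exE)
  fix \<mu> \<sigma> :: real
  assume \<sigma>: "0 < \<sigma>" and D: "distributed M lborel Y (normal_density \<mu> \<sigma>)"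
  have "\<mu> = 0"
    using distributed_integral[OF D, of "\<lambda>x. x"] integral_normal_moment_nz_1[OF \<sigma>, of \<mu>] \<sigma> assms(2)
    by simp
  then show ?thesis using gaussian_moments_normal D \<sigma> by blast
next
  fix \<mu> assume [measurable]: "random_variable borel Y" and AE: "AE \<omega> in M. Y \<omega> = \<mu>"
  have "expectation Y = expectation (\<lambda>_. \<mu>)"
    using AE by (intro integral_cong_AE) auto
  then have "\<mu> = 0" using assms(2) by (simp add: prob_space)
  with AE have AE0: "AE \<omega> in M. Y \<omega> = 0" by simp
  \<comment> \<open>The form \<open>0 ^ n\<close> includes \<open>n = 0\<close>, where the moment is \<open>1\<close>.\<close>
  have moment: "expectation (\<lambda>\<omega>. Y \<omega> ^ n) = 0 ^ n" for n
  proof -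
    have "expectation (\<lambda>\<omega>. Y \<omega> ^ n) = expectation (\<lambda>_. 0 ^ n)"
      using AE0 by (intro integral_cong_AE) auto
    then show ?thesis by (simp add: prob_space)
  qed
  have "integrable M (\<lambda>\<omega>. \<bar>Y \<omega>\<bar> ^ n)" for n
    by (rule iffD2[OF integrable_cong_AE[where g = "\<lambda>_. 0 ^ n"]]) (use AE0 in auto)
  then show ?thesis
    unfolding gaussian_moments_def all_moments_def using assms(2)
    by (simp del: power_Suc add: moment)
qed

text \<open>
  Integration by parts in \<open>A\<close> for the test function \<open>(A + B)\<^sup>n\<^sup>+\<^sup>1\<close>: expand binomially,
  use the moment recursion of \<open>A\<close> in each term, and recombine with
  \<open>i * binomial(n + 1, i) = (n + 1) * binomial(n, i - 1)\<close>.
\<close>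
lemma gaussian_moments_by_parts_indep:
  assumes A: "gaussian_moments A" and B: "all_moments B" and ind: "indep_var borel A borel B"
  shows "expectation (\<lambda>\<omega>. A \<omega> * (A \<omega> + B \<omega>) ^ Suc n) =
    real (Suc n) * expectation (\<lambda>\<omega>. A \<omega> ^ 2) * expectation (\<lambda>\<omega>. (A \<omega> + B \<omega>) ^ n)"
proof -
  have mA: "all_moments A" using A by (simp add: gaussian_moments_def)
  have int: "integrable M (\<lambda>\<omega>. A \<omega> ^ i * B \<omega> ^ j)" for i j
    by (intro all_moments_integrable all_moments_mult all_moments_power mA B)
  have split: "expectation (\<lambda>\<omega>. A \<omega> ^ i * B \<omega> ^ j) = expectation (\<lambda>\<omega>. A \<omega> ^ i) * expectation (\<lambda>\<omega>. B \<omega> ^ j)" for i j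
  proof (rule indep_var_lebesgue_integral)
    show "indep_var borel (\<lambda>\<omega>. A \<omega> ^ i) borel (\<lambda>\<omega>. B \<omega> ^ j)"
      using indep_var_compose[OF ind, of "\<lambda>x. x ^ i" borel "\<lambda>x. x ^ j" borel] by (simp add: comp_def)
  qed (intro all_moments_integrable all_moments_power mA B)+
  have step: "expectation (\<lambda>\<omega>. A \<omega> ^ Suc i * B \<omega> ^ j) =
      real i * expectation (\<lambda>\<omega>. A \<omega> ^ 2) * expectation (\<lambda>\<omega>. A \<omega> ^ (i - 1) * B \<omega> ^ j)" for i j
  proof (cases i)
    case 0
    then show ?thesis using split[of 1 j] A by (simp add: gaussian_moments_def)
  next
    case (Suc k)
    have "expectation (\<lambda>\<omega>. A \<omega> ^ (k + 2)) = real (k + 1) * expectation (\<lambda>\<omega>. A \<omega> ^ 2) * expectation (\<lambda>\<omega>. A \<omega> ^ k)"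
      using A unfolding gaussian_moments_def by blast
    then show ?thesis using Suc by (simp only: split) (simp add: algebra_simps)
  qed
  let ?v = "expectation (\<lambda>\<omega>. A \<omega> ^ 2)"
  have "expectation (\<lambda>\<omega>. A \<omega> * (A \<omega> + B \<omega>) ^ Suc n) =
     expectation (\<lambda>\<omega>. \<Sum>i\<le>Suc n. real (Suc n choose i) * (A \<omega> ^ Suc i * B \<omega> ^ (Suc n - i)))"
    by (intro Bochner_Integration.integral_cong refl)
       (subst binomial_ring, simp only: sum_distrib_left power_Suc mult_ac)
  also have "\<dots> = (\<Sum>i\<le>Suc n. real (Suc n choose i) * expectation (\<lambda>\<omega>. A \<omega> ^ Suc i * B \<omega> ^ (Suc n - i)))"
    by (subst Bochner_Integration.integral_sum)
       (auto intro!: integrable_mult_right int simp del: power_Suc)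
  also have "\<dots> = (\<Sum>i\<le>Suc n. real (Suc n choose i) * (real i * ?v * expectation (\<lambda>\<omega>. A \<omega> ^ (i - 1) * B \<omega> ^ (Suc n - i))))"
    by (simp only: step)
  also have "\<dots> = (\<Sum>i\<le>n. real (Suc n choose Suc i) * (real (Suc i) * ?v * expectation (\<lambda>\<omega>. A \<omega> ^ i * B \<omega> ^ (n - i))))"
    by (subst sum.atMost_Suc_shift) simp
  also have "\<dots> = (\<Sum>i\<le>n. real (Suc n) * ?v * (real (n choose i) * expectation (\<lambda>\<omega>. A \<omega> ^ i * B \<omega> ^ (n - i))))"
  proof (intro sum.cong refl)
    fix i
    have eq: "real (Suc i) * real (Suc n choose Suc i) = real (Suc n) * real (n choose i)"
      using Suc_times_binomial[of i n] by (metis of_nat_mult)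
    have "real (Suc n choose Suc i) * (real (Suc i) * ?v * e) = (real (Suc i) * real (Suc n choose Suc i)) * (?v * e)" for e
      by (simp only: mult_ac)
    then show "real (Suc n choose Suc i) * (real (Suc i) * ?v * expectation (\<lambda>\<omega>. A \<omega> ^ i * B \<omega> ^ (n - i))) =
      real (Suc n) * ?v * (real (n choose i) * expectation (\<lambda>\<omega>. A \<omega> ^ i * B \<omega> ^ (n - i)))"
      by (simp only: eq) (simp only: mult_ac)
  qed
  also have "\<dots> = real (Suc n) * ?v * (\<Sum>i\<le>n. expectation (\<lambda>\<omega>. real (n choose i) * (A \<omega> ^ i * B \<omega> ^ (n - i))))"
    by (simp add: sum_distrib_left)
  also have "(\<Sum>i\<le>n. expectation (\<lambda>\<omega>. real (n choose i) * (A \<omega> ^ i * B \<omega> ^ (n - i)))) =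
      expectation (\<lambda>\<omega>. \<Sum>i\<le>n. real (n choose i) * (A \<omega> ^ i * B \<omega> ^ (n - i)))"
    by (subst Bochner_Integration.integral_sum) (auto intro!: integrable_mult_right int)
  also have "\<dots> = expectation (\<lambda>\<omega>. (A \<omega> + B \<omega>) ^ n)"
    by (intro Bochner_Integration.integral_cong refl) (subst binomial_ring, simp only: mult_ac)
  finally show ?thesis .
qed

lemma indep_var_commute:
  assumes "indep_var S X T Y"
  shows "indep_var T Y S X"
proof -
  have sym: "indep_set B A" if ind: "indep_set A B" for A B
    unfolding indep_sets2_eq
  proof (intro conjI ballI)
    show "B \<subseteq> events" "A \<subseteq> events" using ind unfolding indep_sets2_eq by auto
    fix a b assume "a \<in> B" "b \<in> A"
    then have "prob (b \<inter> a) = prob b * prob a" using ind unfolding indep_sets2_eq by blast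
    then show "prob (a \<inter> b) = prob a * prob b" by (simp only: Int_commute[of a b] mult.commute)
  qed
  show ?thesis
    using assms unfolding indep_var_eq by (elim conjE) (rule conjI[OF conjI sym])
qed

text \<open>
  Split off one factor of \<open>(A + B)\<^sup>n\<^sup>+\<^sup>2\<close> as \<open>A + B\<close> and integrate by parts in each of the two
  variables; the variances add up.
\<close>
lemma gaussian_moments_indep_add:
  assumes A: "gaussian_moments A" and B: "gaussian_moments B" and ind: "indep_var borel A borel B"
  shows "gaussian_moments (\<lambda>\<omega>. A \<omega> + B \<omega>)"
proof -
  have mA: "all_moments A" and mB: "all_moments B" using A B by (auto simp: gaussian_moments_def)
  have intA: "integrable M (\<lambda>\<omega>. A \<omega> * (A \<omega> + B \<omega>) ^ n)"
    and intB: "integrable M (\<lambda>\<omega>. B \<omega> * (A \<omega> + B \<omega>) ^ n)" for n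
    by (intro all_moments_integrable all_moments_mult all_moments_power all_moments_add mA mB)+
  let ?a = "expectation (\<lambda>\<omega>. A \<omega> ^ 2)" and ?b = "expectation (\<lambda>\<omega>. B \<omega> ^ 2)"
  have swap: "B \<omega> + A \<omega> = A \<omega> + B \<omega>" for \<omega>
    by (rule add.commute)
  have stepB: "expectation (\<lambda>\<omega>. B \<omega> * (A \<omega> + B \<omega>) ^ Suc n) =
      real (Suc n) * ?b * expectation (\<lambda>\<omega>. (A \<omega> + B \<omega>) ^ n)" for n
    using gaussian_moments_by_parts_indep[OF B mA indep_var_commute[OF ind], of n] by (simp only: swap)
  have step: "expectation (\<lambda>\<omega>. (A \<omega> + B \<omega>) ^ (n + 2)) =
      real (Suc n) * (?a + ?b) * expectation (\<lambda>\<omega>. (A \<omega> + B \<omega>) ^ n)" for n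
  proof -
    have "expectation (\<lambda>\<omega>. (A \<omega> + B \<omega>) ^ (n + 2)) =
      expectation (\<lambda>\<omega>. A \<omega> * (A \<omega> + B \<omega>) ^ Suc n + B \<omega> * (A \<omega> + B \<omega>) ^ Suc n)"
      by (simp add: algebra_simps)
    also have "\<dots> = expectation (\<lambda>\<omega>. A \<omega> * (A \<omega> + B \<omega>) ^ Suc n) + expectation (\<lambda>\<omega>. B \<omega> * (A \<omega> + B \<omega>) ^ Suc n)"
      by (intro Bochner_Integration.integral_add intA intB)
    also have "\<dots> = real (Suc n) * (?a + ?b) * expectation (\<lambda>\<omega>. (A \<omega> + B \<omega>) ^ n)"
      by (simp only: gaussian_moments_by_parts_indep[OF A mB ind, of n] stepB) (simp only: distrib_left distrib_right)
    finally show ?thesis .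
  qed
  have two: "expectation (\<lambda>\<omega>. (A \<omega> + B \<omega>) ^ 2) = ?a + ?b"
    using step[of 0] by (simp add: prob_space power2_eq_square)
  have "expectation (\<lambda>\<omega>. A \<omega> + B \<omega>) = expectation A + expectation B"
    by (intro Bochner_Integration.integral_add all_moments_integrable mA mB)
  also have "\<dots> = 0" using A B by (simp add: gaussian_moments_def)
  finally show ?thesis
    unfolding gaussian_moments_def two using all_moments_add[OF mA mB] step by (simp only: Suc_eq_plus1) simp
qed

lemma gaussian_moments_zero: "gaussian_moments (\<lambda>_. 0)"
  by (auto simp: gaussian_moments_def all_moments_const)

lemma gaussian_moments_indep_sum:
  assumes "finite I" "indep_vars (\<lambda>_. borel) Y I" "\<And>i. i \<in> I \<Longrightarrow> gaussian_moments (Y i)"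
  shows "gaussian_moments (\<lambda>\<omega>. \<Sum>i\<in>I. Y i \<omega>)"
  using assms
proof (induction I rule: finite_induct)
  case empty
  then show ?case by (simp add: gaussian_moments_zero)
next
  case (insert i I)
  have "indep_var borel (Y i) borel (\<lambda>\<omega>. \<Sum>i\<in>I. Y i \<omega>)"
    using insert by (intro indep_vars_sum) auto
  moreover have "gaussian_moments (\<lambda>\<omega>. \<Sum>i\<in>I. Y i \<omega>)"
    using insert by (intro insert.IH indep_vars_subset[OF insert.prems(1)]) auto
  ultimately show ?case
    using insert by (simp add: gaussian_moments_indep_add)
qed

end


section \<open>Gaussian integration by parts\<close>

lemma has_vector_derivative_poly_0:
  fixes n :: nat and c :: "nat \<Rightarrow> complex"
  shows "((\<lambda>s. \<Sum>k\<le>n. of_real (s ^ k) * c k) has_vector_derivative (if n = 0 then 0 else c 1)) (at 0)"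
proof -
  have "((\<lambda>s. of_real (s ^ k) * c k) has_vector_derivative (if k = 1 then c k else 0)) (at 0)" for k
  proof -
    have "((\<lambda>s::real. s ^ k) has_real_derivative (if k = 1 then 1 else 0)) (at 0)"
      by (rule derivative_eq_intros refl)+ (cases "k = 0 \<or> k = 1"; auto)
    then have "((\<lambda>s::real. complex_of_real (s ^ k)) has_vector_derivative of_real (if k = 1 then 1 else 0)) (at 0)"
      by (intro has_vector_derivative_of_real) (simp add: has_real_derivative_iff_has_vector_derivative)
    then show ?thesis
      by (drule_tac has_vector_derivative_mult_left[where a = "c k"]) (simp split: if_splits)
  qed
  then have "((\<lambda>s. \<Sum>k\<le>n. of_real (s ^ k) * c k) has_vector_derivative (\<Sum>k\<le>n. if k = 1 then c k else 0)) (at 0)"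
    by (intro has_vector_derivative_sum)
  also have "(\<Sum>k\<le>n. if k = 1 then c k else 0) = (if n = 0 then 0 else c 1)"
    by (subst sum.delta) auto
  finally show ?thesis .
qed

context prob_space
begin

text \<open>
  Polarization is done by differentiating at \<open>s = 0\<close>. The expectation is a polynomial
  in \<open>s\<close>, whence no interchange of limits is involved.
\<close>
lemma has_vector_derivative_expectation_power:
  assumes Z: "all_moments Z" and h: "all_moments h" and F: "all_moments F"
  shows "((\<lambda>s. expectation (\<lambda>\<omega>. complex_of_real (Z \<omega> + s * h \<omega>) ^ n * F \<omega>)) has_vector_derivative
     of_nat n * expectation (\<lambda>\<omega>. complex_of_real (Z \<omega>) ^ (n - 1) * (of_real (h \<omega>) * F \<omega>))) (at 0)"
proof -
  define c where "c k = of_nat (n choose k) *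
    expectation (\<lambda>\<omega>. complex_of_real (h \<omega>) ^ k * complex_of_real (Z \<omega>) ^ (n - k) * F \<omega>)" for k
  have int: "integrable M (\<lambda>\<omega>. complex_of_real (h \<omega>) ^ k * complex_of_real (Z \<omega>) ^ (n - k) * F \<omega>)" for k
    by (intro all_moments_integrable all_moments_mult all_moments_power all_moments_of_real Z h F)
  have "expectation (\<lambda>\<omega>. complex_of_real (Z \<omega> + s * h \<omega>) ^ n * F \<omega>) = (\<Sum>k\<le>n. of_real (s ^ k) * c k)" for s
  proof -
    have "expectation (\<lambda>\<omega>. complex_of_real (Z \<omega> + s * h \<omega>) ^ n * F \<omega>) =
      expectation (\<lambda>\<omega>. \<Sum>k\<le>n. (of_real (s ^ k) * of_nat (n choose k)) *
        (complex_of_real (h \<omega>) ^ k * complex_of_real (Z \<omega>) ^ (n - k) * F \<omega>))"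
    proof (intro Bochner_Integration.integral_cong refl)
      fix \<omega>
      have "complex_of_real (Z \<omega> + s * h \<omega>) ^ n = (of_real (s * h \<omega>) + of_real (Z \<omega>)) ^ n"
        by (simp add: add.commute)
      then show "complex_of_real (Z \<omega> + s * h \<omega>) ^ n * F \<omega> =
        (\<Sum>k\<le>n. (of_real (s ^ k) * of_nat (n choose k)) *
        (complex_of_real (h \<omega>) ^ k * complex_of_real (Z \<omega>) ^ (n - k) * F \<omega>))"
        by (simp only: binomial_ring sum_distrib_right) (simp add: power_mult_distrib mult_ac)
    qed
    also have "\<dots> = (\<Sum>k\<le>n. (of_real (s ^ k) * of_nat (n choose k)) * expectation (\<lambda>\<omega>.
        (complex_of_real (h \<omega>) ^ k * complex_of_real (Z \<omega>) ^ (n - k) * F \<omega>)))"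
      by (subst Bochner_Integration.integral_sum) (auto intro!: integrable_mult_right int)
    finally show ?thesis by (simp add: c_def mult_ac)
  qed
  moreover have "(if n = 0 then 0 else c 1) =
    of_nat n * expectation (\<lambda>\<omega>. complex_of_real (Z \<omega>) ^ (n - 1) * (of_real (h \<omega>) * F \<omega>))"
    by (simp add: c_def mult_ac)
  ultimately show ?thesis
    using has_vector_derivative_poly_0[of c n] by (simp only:)
qed

end

text \<open>
  Closure under linear combinations makes the members jointly Gaussian, although only the moments
  of single members are prescribed.
\<close>
locale gaussian_space = prob_space +
  fixes V :: "('a \<Rightarrow> real) set"
  assumes V_add: "u \<in> V \<Longrightarrow> v \<in> V \<Longrightarrow> (\<lambda>\<omega>. u \<omega> + v \<omega>) \<in> V"
    and V_scale: "u \<in> V \<Longrightarrow> (\<lambda>\<omega>. a * u \<omega>) \<in> V"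
    and V_gaussian: "u \<in> V \<Longrightarrow> gaussian_moments u"
begin

lemma V_all_moments: "u \<in> V \<Longrightarrow> all_moments u"
  using V_gaussian by (auto simp: gaussian_moments_def)

lemma V_add_scale: "u \<in> V \<Longrightarrow> v \<in> V \<Longrightarrow> (\<lambda>\<omega>. u \<omega> + s * v \<omega>) \<in> V"
  by (intro V_add V_scale)

text \<open>
  Matrix entries are complex combinations of real Gaussian variables. The bilinear form
  \<open>E[g h]\<close>, without conjugation, is the covariance that occurs in Wick's formula for them.
\<close>
definition complexification :: "('a \<Rightarrow> complex) set" where
  "complexification = {g. \<exists>u\<in>V. \<exists>v\<in>V. g = (\<lambda>\<omega>. of_real (u \<omega>) + \<i> * of_real (v \<omega>))}"

lemma complexificationE:
  assumes "g \<in> complexification"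
  obtains u v where "u \<in> V" "v \<in> V" "g = (\<lambda>\<omega>. of_real (u \<omega>) + \<i> * of_real (v \<omega>))"
  using assms by (auto simp: complexification_def)

lemma complexification_all_moments: "g \<in> complexification \<Longrightarrow> all_moments g"
  by (elim complexificationE)
     (auto intro!: all_moments_add all_moments_mult all_moments_const all_moments_of_real V_all_moments)

text \<open>
  Polarization of the moment recursion in direction \<open>g\<close>. Differentiating
  \<open>E[(Z + s g)\<^sup>k\<^sup>+\<^sup>2] = (k + 1) E[(Z + s g)\<^sup>2] E[(Z + s g)\<^sup>k]\<close> at \<open>s = 0\<close> gives
  \<open>(k + 2) E[Z\<^sup>k\<^sup>+\<^sup>1 g] = (k + 1) (2 E[Z g] E[Z\<^sup>k] + k E[Z\<^sup>2] E[Z\<^sup>k\<^sup>-\<^sup>1 g])\<close>, and the last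
  expectation is known by induction.
\<close>
lemma expectation_power_mult:
  assumes Z: "Z \<in> V" and g: "g \<in> V"
  shows "expectation (\<lambda>\<omega>. complex_of_real (Z \<omega>) ^ n * of_real (g \<omega>)) =
    of_nat n * expectation (\<lambda>\<omega>. of_real (g \<omega>) * of_real (Z \<omega>)) *
      expectation (\<lambda>\<omega>. complex_of_real (Z \<omega>) ^ (n - 1))"
proof (induction n rule: less_induct)
  case (less n)
  define C where "C = expectation (\<lambda>\<omega>. complex_of_real (g \<omega>) * of_real (Z \<omega>))"
  define m where "m k = expectation (\<lambda>\<omega>. complex_of_real (Z \<omega>) ^ k)" for k
  define e where "e k = expectation (\<lambda>\<omega>. complex_of_real (Z \<omega>) ^ k * of_real (g \<omega>))" for k
  have IH: "e k = of_nat k * C * m (k - 1)" if "k < n" for k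
    using less[OF that] by (simp add: e_def C_def m_def)
  have rec: "expectation (\<lambda>\<omega>. complex_of_real (U \<omega>) ^ (k + 2)) =
      of_nat (k + 1) * (expectation (\<lambda>\<omega>. complex_of_real (U \<omega>) ^ 2) * expectation (\<lambda>\<omega>. complex_of_real (U \<omega>) ^ k))"
    if "U \<in> V" for U k
  proof -
    have "expectation (\<lambda>\<omega>. U \<omega> ^ (k + 2)) = real (k + 1) * expectation (\<lambda>\<omega>. U \<omega> ^ 2) * expectation (\<lambda>\<omega>. U \<omega> ^ k)"
      using V_gaussian[OF that] by (auto simp: gaussian_moments_def)
    then have "complex_of_real (expectation (\<lambda>\<omega>. U \<omega> ^ (k + 2))) =
      of_real (real (k + 1) * expectation (\<lambda>\<omega>. U \<omega> ^ 2) * expectation (\<lambda>\<omega>. U \<omega> ^ k))" by (simp only:)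
    then show ?thesis
      by (simp only: of_real_mult integral_complex_of_real[symmetric] of_real_power of_real_of_nat_eq mult.assoc)
  qed
  have mean: "expectation (\<lambda>\<omega>. complex_of_real (U \<omega>)) = 0" if "U \<in> V" for U
    using V_gaussian[OF that] by (simp add: gaussian_moments_def)
  show ?case
  proof (cases "n < 2")
    case True
    then have "n = 0 \<or> n = 1" by auto
    then show ?thesis
      using mean[OF g] by (auto simp: prob_space mult.commute)
  next
    case False
    then obtain k where n: "n = k + 1" "k > 0" by (intro that[of "n - 1"]) auto
    have deriv: "((\<lambda>s. expectation (\<lambda>\<omega>. complex_of_real (Z \<omega> + s * g \<omega>) ^ j)) has_vector_derivative
      of_nat j * e (j - 1)) (at 0)" for j
      using has_vector_derivative_expectation_power[OF V_all_moments[OF Z] V_all_moments[OF g] all_moments_const[of 1], of j]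
      by (simp add: e_def)
    have "((\<lambda>s. of_nat (k + 1) * (expectation (\<lambda>\<omega>. complex_of_real (Z \<omega> + s * g \<omega>) ^ 2) *
        expectation (\<lambda>\<omega>. complex_of_real (Z \<omega> + s * g \<omega>) ^ k))) has_vector_derivative
        of_nat (k + 1) * (m 2 * (of_nat k * e (k - 1)) + (of_nat 2 * e (2 - 1)) * m k)) (at 0)"
      using has_vector_derivative_mult[OF deriv[of 2] deriv[of k]]
      by (intro has_vector_derivative_mult_right) (simp add: m_def)
    then have "((\<lambda>s. expectation (\<lambda>\<omega>. complex_of_real (Z \<omega> + s * g \<omega>) ^ (k + 2))) has_vector_derivative
        of_nat (k + 1) * (m 2 * (of_nat k * e (k - 1)) + (of_nat 2 * e (2 - 1)) * m k)) (at 0)"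
      by (simp only: rec[OF V_add_scale[OF Z g]])
    from vector_derivative_unique_at[OF deriv[of "k + 2"] this]
    have eq: "of_nat (k + 2) * e n = of_nat (k + 1) * (of_nat k * m 2 * e (k - 1) + 2 * e 1 * m k)"
      by (simp add: n mult_ac)
    have e1: "e 1 = C" by (simp add: e_def C_def mult.commute)
    \<comment> \<open>For \<open>k = 1\<close> both sides vanish, as \<open>Z\<close> and \<open>g\<close> are centered.\<close>
    have X: "of_nat k * m 2 * e (k - 1) = of_nat k * C * m k"
    proof (cases "k = 1")
      case True
      then show ?thesis using mean[OF Z] mean[OF g] by (simp add: e_def m_def)
    next
      case False
      define j where "j = k - 2"
      have k: "k = j + 2" using False n by (simp add: j_def)
      have "m k = of_nat (j + 1) * (m 2 * m j)" unfolding k m_def by (rule rec[OF Z])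
      moreover have "e (k - 1) = of_nat (j + 1) * C * m j" using IH[of "k - 1"] n by (simp add: k)
      ultimately show ?thesis by simp
    qed
    have "of_nat (k + 2) * e n = of_nat (k + 2) * (of_nat n * C * m k)"
      unfolding eq e1 X by (simp add: n algebra_simps)
    moreover have "of_nat (k + 2) \<noteq> (0 :: complex)" by (simp only: of_nat_eq_0_iff)
    ultimately have "e n = of_nat n * C * m k" by (simp only: mult_cancel_left simp_thms)
    then show ?thesis by (simp add: e_def C_def m_def n)
  qed
qed

text \<open>
  The derivation \<open>D\<close> on polynomials in the Gaussian variables with \<open>D u = E[g u]\<close>, the
  derivative in direction \<open>g\<close> of Malliavin calculus. Random variables do not
  determine polynomials, so \<open>D\<close> is a relation, generated along the ways to build up a
  polynomial. Only multiplication by a single variable of the space is a generating rule: this makes the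
  proof of integration by parts an induction, and the product rule for arbitrary factors follows afterwards.
\<close>
inductive wick_derivative :: "('a \<Rightarrow> complex) \<Rightarrow> ('a \<Rightarrow> complex) \<Rightarrow> ('a \<Rightarrow> complex) \<Rightarrow> bool"
  for g :: "'a \<Rightarrow> complex" where
  one: "wick_derivative g (\<lambda>_. 1) (\<lambda>_. 0)"
| mult_generator: "u \<in> V \<Longrightarrow> wick_derivative g F D \<Longrightarrow>
    wick_derivative g (\<lambda>\<omega>. of_real (u \<omega>) * F \<omega>)
      (\<lambda>\<omega>. expectation (\<lambda>\<omega>. g \<omega> * of_real (u \<omega>)) * F \<omega> + of_real (u \<omega>) * D \<omega>)"
| add: "wick_derivative g F D \<Longrightarrow> wick_derivative g F' D' \<Longrightarrow>
    wick_derivative g (\<lambda>\<omega>. F \<omega> + F' \<omega>) (\<lambda>\<omega>. D \<omega> + D' \<omega>)"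
| scale: "wick_derivative g F D \<Longrightarrow> wick_derivative g (\<lambda>\<omega>. a * F \<omega>) (\<lambda>\<omega>. a * D \<omega>)"

lemma wick_derivative_all_moments:
  "wick_derivative g F D \<Longrightarrow> all_moments F \<and> all_moments D"
  by (induction rule: wick_derivative.induct)
     (auto intro!: all_moments_add all_moments_mult all_moments_const all_moments_of_real V_all_moments)

text \<open>
  The factor \<open>Z\<^sup>n\<close> carries the induction: to multiply \<open>F\<close> by one more variable \<open>u\<close>, replace
  \<open>Z\<close> by \<open>Z + s u\<close> in the formula for the exponent \<open>n + 1\<close> and compare the derivatives at
  \<open>s = 0\<close>. For \<open>F = 1\<close> the formula is \<open>expectation_power_mult\<close>, extended to complex
  \<open>g\<close> by linearity.
\<close>
lemma expectation_power_wick_derivative: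
  assumes g: "g \<in> complexification" and "wick_derivative g F D" and "Z \<in> V"
  shows "expectation (\<lambda>\<omega>. complex_of_real (Z \<omega>) ^ n * (g \<omega> * F \<omega>)) =
    of_nat n * expectation (\<lambda>\<omega>. g \<omega> * of_real (Z \<omega>)) * expectation (\<lambda>\<omega>. complex_of_real (Z \<omega>) ^ (n - 1) * F \<omega>)
    + expectation (\<lambda>\<omega>. complex_of_real (Z \<omega>) ^ n * D \<omega>)"
  using assms(2,3)
proof (induction arbitrary: Z n rule: wick_derivative.induct)
  case one
  from g obtain u v where u: "u \<in> V" and v: "v \<in> V"
    and g_eq: "g = (\<lambda>\<omega>. of_real (u \<omega>) + \<i> * of_real (v \<omega>))" by (rule complexificationE)
  have int: "integrable M (\<lambda>\<omega>. complex_of_real (Z \<omega>) ^ j * of_real (w \<omega>))"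
    "integrable M (\<lambda>\<omega>. of_real (w \<omega>) * complex_of_real (Z \<omega>))" if "w \<in> V" for w j
    using that one by (auto intro!: all_moments_integrable all_moments_mult all_moments_power all_moments_of_real V_all_moments)
  have "expectation (\<lambda>\<omega>. complex_of_real (Z \<omega>) ^ n * (g \<omega> * 1)) =
    expectation (\<lambda>\<omega>. complex_of_real (Z \<omega>) ^ n * of_real (u \<omega>)) + \<i> * expectation (\<lambda>\<omega>. complex_of_real (Z \<omega>) ^ n * of_real (v \<omega>))"
    using int(1)[OF u, of n] int(1)[OF v, of n] by (simp add: g_eq algebra_simps)
  also have "\<dots> = of_nat n * (expectation (\<lambda>\<omega>. of_real (u \<omega>) * of_real (Z \<omega>)) + \<i> * expectation (\<lambda>\<omega>. of_real (v \<omega>) * of_real (Z \<omega>))) *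
      expectation (\<lambda>\<omega>. complex_of_real (Z \<omega>) ^ (n - 1))"
    by (simp only: expectation_power_mult[OF one u] expectation_power_mult[OF one v]) (simp add: algebra_simps)
  also have "expectation (\<lambda>\<omega>. of_real (u \<omega>) * complex_of_real (Z \<omega>)) + \<i> * expectation (\<lambda>\<omega>. of_real (v \<omega>) * complex_of_real (Z \<omega>)) =
      expectation (\<lambda>\<omega>. g \<omega> * of_real (Z \<omega>))"
    using int(2)[OF u] int(2)[OF v] by (simp add: g_eq algebra_simps)
  finally show ?case by simp
next
  case (mult_generator u F D)
  have mF: "all_moments F" and mD: "all_moments D"
    using wick_derivative_all_moments[OF mult_generator(2)] by auto
  have mZ: "all_moments Z" and mu: "all_moments u" and mg: "all_moments g"
    using mult_generator V_all_moments complexification_all_moments g by auto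
  note moments = mF mD mZ mu mg all_moments_mult all_moments_power all_moments_of_real
  have int: "integrable M (\<lambda>\<omega>. of_real (u \<omega>) * g \<omega>)" "integrable M (\<lambda>\<omega>. of_real (Z \<omega>) * g \<omega>)"
    "integrable M (\<lambda>\<omega>. complex_of_real (Z \<omega>) ^ j * F \<omega>)"
    "integrable M (\<lambda>\<omega>. complex_of_real (Z \<omega>) ^ j * (of_real (u \<omega>) * D \<omega>))" for j
    by (intro all_moments_integrable moments)+
  let ?C = "\<lambda>w. expectation (\<lambda>\<omega>. g \<omega> * complex_of_real (w \<omega>))"
  let ?Z = "\<lambda>s \<omega>. complex_of_real (Z \<omega> + s * u \<omega>)"
  have lin: "?C (\<lambda>\<omega>. Z \<omega> + s * u \<omega>) = ?C Z + of_real s * ?C u" for s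
    using int(1,2) by (simp add: algebra_simps)
  have left: "((\<lambda>s. expectation (\<lambda>\<omega>. ?Z s \<omega> ^ Suc n * (g \<omega> * F \<omega>))) has_vector_derivative
     of_nat (Suc n) * expectation (\<lambda>\<omega>. complex_of_real (Z \<omega>) ^ n * (of_real (u \<omega>) * (g \<omega> * F \<omega>)))) (at 0)"
    using has_vector_derivative_expectation_power[OF mZ mu all_moments_mult[OF mg mF], of "Suc n"] by simp
  have "((\<lambda>s. complex_of_real s) has_vector_derivative of_real 1) (at 0)"
    by (intro has_vector_derivative_of_real) (simp add: has_vector_derivative_id)
  from has_vector_derivative_add[OF has_vector_derivative_const[of "?C Z"] has_vector_derivative_mult_left[OF this, of "?C u"]]
  have dC: "((\<lambda>s. ?C Z + of_real s * ?C u) has_vector_derivative ?C u) (at 0)" by simp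
  have "((\<lambda>s. of_nat (Suc n) * ((?C Z + of_real s * ?C u) * expectation (\<lambda>\<omega>. ?Z s \<omega> ^ n * F \<omega>))
      + expectation (\<lambda>\<omega>. ?Z s \<omega> ^ Suc n * D \<omega>)) has_vector_derivative
    of_nat (Suc n) * ((?C Z * (of_nat n * expectation (\<lambda>\<omega>. complex_of_real (Z \<omega>) ^ (n - 1) * (of_real (u \<omega>) * F \<omega>))) +
      ?C u * expectation (\<lambda>\<omega>. complex_of_real (Z \<omega>) ^ n * F \<omega>))) +
    of_nat (Suc n) * expectation (\<lambda>\<omega>. complex_of_real (Z \<omega>) ^ n * (of_real (u \<omega>) * D \<omega>))) (at 0)"
    using has_vector_derivative_mult[OF dC has_vector_derivative_expectation_power[OF mZ mu mF, of n]]
      has_vector_derivative_expectation_power[OF mZ mu mD, of "Suc n"]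
    by (intro has_vector_derivative_add has_vector_derivative_mult_right) simp_all
  moreover have "expectation (\<lambda>\<omega>. ?Z s \<omega> ^ Suc n * (g \<omega> * F \<omega>)) =
      of_nat (Suc n) * ((?C Z + of_real s * ?C u) * expectation (\<lambda>\<omega>. ?Z s \<omega> ^ n * F \<omega>))
      + expectation (\<lambda>\<omega>. ?Z s \<omega> ^ Suc n * D \<omega>)" for s
    using mult_generator.IH[OF V_add_scale[OF mult_generator(4) mult_generator(1)], of s "Suc n"]
    by (simp only: lin diff_Suc_1 mult.assoc)
  ultimately have "((\<lambda>s. expectation (\<lambda>\<omega>. ?Z s \<omega> ^ Suc n * (g \<omega> * F \<omega>))) has_vector_derivative
    of_nat (Suc n) * ((?C Z * (of_nat n * expectation (\<lambda>\<omega>. complex_of_real (Z \<omega>) ^ (n - 1) * (of_real (u \<omega>) * F \<omega>))) +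
      ?C u * expectation (\<lambda>\<omega>. complex_of_real (Z \<omega>) ^ n * F \<omega>))) +
    of_nat (Suc n) * expectation (\<lambda>\<omega>. complex_of_real (Z \<omega>) ^ n * (of_real (u \<omega>) * D \<omega>))) (at 0)"
    by (simp only:)
  from vector_derivative_unique_at[OF left this]
  have "expectation (\<lambda>\<omega>. complex_of_real (Z \<omega>) ^ n * (of_real (u \<omega>) * (g \<omega> * F \<omega>))) =
    (?C Z * (of_nat n * expectation (\<lambda>\<omega>. complex_of_real (Z \<omega>) ^ (n - 1) * (of_real (u \<omega>) * F \<omega>))) +
      ?C u * expectation (\<lambda>\<omega>. complex_of_real (Z \<omega>) ^ n * F \<omega>)) +
    expectation (\<lambda>\<omega>. complex_of_real (Z \<omega>) ^ n * (of_real (u \<omega>) * D \<omega>))"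
    by (simp only: distrib_left[symmetric] mult_cancel_left of_nat_eq_0_iff nat.distinct simp_thms)
  moreover have "expectation (\<lambda>\<omega>. complex_of_real (Z \<omega>) ^ n * (?C u * F \<omega> + of_real (u \<omega>) * D \<omega>)) =
    ?C u * expectation (\<lambda>\<omega>. complex_of_real (Z \<omega>) ^ n * F \<omega>) +
    expectation (\<lambda>\<omega>. complex_of_real (Z \<omega>) ^ n * (of_real (u \<omega>) * D \<omega>))"
    using int(3,4)[of n]
    by (simp only: distrib_left mult.left_commute[of _ "?C u"] Bochner_Integration.integral_add
        integrable_mult_right integral_mult_right_zero)
  ultimately show ?case by (simp add: mult_ac)
next
  case (add F D F' D')
  have m: "all_moments F" "all_moments D" "all_moments F'" "all_moments D'"
    using wick_derivative_all_moments add by auto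
  have mZ: "all_moments Z" and mg: "all_moments g"
    using add V_all_moments complexification_all_moments g by auto
  have int: "integrable M (\<lambda>\<omega>. complex_of_real (Z \<omega>) ^ j * (g \<omega> * f \<omega>))"
     "integrable M (\<lambda>\<omega>. complex_of_real (Z \<omega>) ^ j * f \<omega>)" if "all_moments f" for j f
    by (intro all_moments_integrable that mZ mg all_moments_mult all_moments_power all_moments_of_real)+
  show ?case
    using add.IH(1)[OF add.prems, of n] add.IH(2)[OF add.prems, of n]
    by (simp only: distrib_left Bochner_Integration.integral_add int m) (simp add: algebra_simps)
next
  case (scale F D a)
  show ?case
    using scale.IH[OF scale.prems, of n] by (simp add: mult.left_commute[of _ a] distrib_left)
qed

lemma expectation_wick_derivative:
  assumes "g \<in> complexification" "wick_derivative g F D"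
  shows "expectation (\<lambda>\<omega>. g \<omega> * F \<omega>) = expectation D"
proof -
  obtain Z where "Z \<in> V" using assms(1) by (auto simp: complexification_def)
  from expectation_power_wick_derivative[OF assms this, of 0] show ?thesis by simp
qed

lemma wick_derivative_cong:
  "wick_derivative g F D \<Longrightarrow> (\<And>\<omega>. F' \<omega> = F \<omega>) \<Longrightarrow> (\<And>\<omega>. D' \<omega> = D \<omega>) \<Longrightarrow> wick_derivative g F' D'"
  by (simp add: ext[of F' F] ext[of D' D])

lemma wick_derivative_const: "wick_derivative g (\<lambda>_. c) (\<lambda>_. 0)"
  using scale[OF one, of g c] by simp

lemma wick_derivative_complexification:
  assumes "h \<in> complexification" "all_moments g"
  shows "wick_derivative g h (\<lambda>_. expectation (\<lambda>\<omega>. g \<omega> * h \<omega>))"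
proof -
  from assms(1) obtain u v where u: "u \<in> V" and v: "v \<in> V"
    and h: "h = (\<lambda>\<omega>. of_real (u \<omega>) + \<i> * of_real (v \<omega>))" by (rule complexificationE)
  have int: "integrable M (\<lambda>\<omega>. g \<omega> * of_real (w \<omega>))" if "w \<in> V" for w
    using that assms(2) by (auto intro!: all_moments_integrable all_moments_mult all_moments_of_real V_all_moments)
  have "wick_derivative g (\<lambda>\<omega>. of_real (u \<omega>) * 1 + \<i> * (of_real (v \<omega>) * 1))
    (\<lambda>\<omega>. (expectation (\<lambda>\<omega>. g \<omega> * of_real (u \<omega>)) * 1 + of_real (u \<omega>) * 0) +
      \<i> * (expectation (\<lambda>\<omega>. g \<omega> * of_real (v \<omega>)) * 1 + of_real (v \<omega>) * 0))"
    by (intro add scale mult_generator u v one)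
  then show ?thesis
    using int[OF u] int[OF v]
    by (rule_tac wick_derivative_cong) (simp_all add: h distrib_left mult.left_commute)
qed

lemma wick_derivative_mult:
  assumes "wick_derivative g F D" and F': "wick_derivative g F' D'"
  shows "wick_derivative g (\<lambda>\<omega>. F \<omega> * F' \<omega>) (\<lambda>\<omega>. D \<omega> * F' \<omega> + F \<omega> * D' \<omega>)"
  using assms(1)
proof induction
  case one
  show ?case using F' by simp
next
  case (mult_generator u F D)
  show ?case
    by (rule wick_derivative_cong[OF wick_derivative.mult_generator[OF mult_generator(1,3)]])
       (simp_all add: algebra_simps)
next
  case (add F D G E)
  show ?case
    by (rule wick_derivative_cong[OF wick_derivative.add[OF add.IH]]) (simp_all add: algebra_simps)
next
  case (scale F D a)
  show ?case
    by (rule wick_derivative_cong[OF wick_derivative.scale[OF scale.IH, of a]]) (simp_all add: algebra_simps)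
qed

lemma wick_derivative_sum:
  "(\<And>i. i \<in> I \<Longrightarrow> wick_derivative g (F i) (D i)) \<Longrightarrow>
    wick_derivative g (\<lambda>\<omega>. \<Sum>i\<in>I. F i \<omega>) (\<lambda>\<omega>. \<Sum>i\<in>I. D i \<omega>)"
  by (induction I rule: infinite_finite_induct) (auto intro: wick_derivative_const wick_derivative.add)

end


section \<open>Schwinger--Dyson equations for Gaussian Hermitian matrices\<close>

text \<open>
  The only information about the matrices that matters is the covariance of their entries; it is that
  of the Gaussian unitary ensemble with a covariance kernel \<open>c\<close> in the parameter.
\<close>
locale hermitian_gaussian_matrices = gaussian_space +
  fixes d :: nat and S :: "'t set" and c :: "'t \<Rightarrow> 't \<Rightarrow> real"
    and X :: "'t \<Rightarrow> nat \<Rightarrow> nat \<Rightarrow> 'a \<Rightarrow> complex"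
  assumes d_pos: "0 < d"
    and entry: "s \<in> S \<Longrightarrow> i < d \<Longrightarrow> j < d \<Longrightarrow> X s i j \<in> complexification"
    and covariance: "s \<in> S \<Longrightarrow> t \<in> S \<Longrightarrow> i < d \<Longrightarrow> j < d \<Longrightarrow> k < d \<Longrightarrow> l < d \<Longrightarrow>
      expectation (\<lambda>\<omega>. X s i j \<omega> * X t k l \<omega>) = (if i = l \<and> j = k then of_real (c s t) / of_nat d else 0)"
begin

fun word_entry :: "'t list \<Rightarrow> nat \<Rightarrow> nat \<Rightarrow> 'a \<Rightarrow> complex" where
  "word_entry [] i j \<omega> = (if i = j then 1 else 0)"
| "word_entry (s # w) i j \<omega> = (\<Sum>k<d. X s i k \<omega> * word_entry w k j \<omega>)"

definition trace :: "'t list \<Rightarrow> 'a \<Rightarrow> complex" where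
  "trace w \<omega> = (\<Sum>i<d. word_entry w i i \<omega>)"

lemma word_append:
  "i < d \<Longrightarrow> word_entry (u @ v) i j \<omega> = (\<Sum>k<d. word_entry u i k \<omega> * word_entry v k j \<omega>)"
proof (induction u arbitrary: i)
  case Nil
  have "(\<Sum>k<d. word_entry [] i k \<omega> * word_entry v k j \<omega>) = (\<Sum>k<d. if k = i then word_entry v k j \<omega> else 0)"
    by (intro sum.cong) auto
  then show ?case using Nil by simp
next
  case (Cons s u)
  have "word_entry ((s # u) @ v) i j \<omega> = (\<Sum>l<d. \<Sum>k<d. X s i l \<omega> * (word_entry u l k \<omega> * word_entry v k j \<omega>))"
    using Cons by (simp add: sum_distrib_left)
  also have "\<dots> = (\<Sum>k<d. \<Sum>l<d. X s i l \<omega> * (word_entry u l k \<omega> * word_entry v k j \<omega>))"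
    by (rule sum.swap)
  finally show ?case by (simp add: sum_distrib_right mult.assoc)
qed

lemma trace_append: "trace (u @ v) \<omega> = (\<Sum>i<d. \<Sum>k<d. word_entry u i k \<omega> * word_entry v k i \<omega>)"
  by (simp add: trace_def word_append)

lemma entry_all_moments: "s \<in> S \<Longrightarrow> i < d \<Longrightarrow> j < d \<Longrightarrow> all_moments (X s i j)"
  using entry complexification_all_moments by blast

lemma word_all_moments: "set w \<subseteq> S \<Longrightarrow> i < d \<Longrightarrow> j < d \<Longrightarrow> all_moments (word_entry w i j)"
proof (induction w arbitrary: i)
  case Nil
  then show ?case by (simp add: all_moments_const)
next
  case (Cons s w)
  then show ?case by (auto intro!: all_moments_sum all_moments_mult entry_all_moments)
qed

lemma trace_all_moments: "set w \<subseteq> S \<Longrightarrow> all_moments (trace w)"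
  unfolding trace_def by (auto intro!: all_moments_sum word_all_moments)

text \<open>
  The covariance of the entries which are paired when a matrix with parameter \<open>a\<close> meets the
  letter at position \<open>m\<close> of \<open>w\<close>.
\<close>
definition contraction :: "'t \<Rightarrow> 't list \<Rightarrow> nat \<Rightarrow> complex" where
  "contraction a w m = of_real (c a (w ! m)) / of_nat d"

text \<open>
  Pairing \<open>X\<^sub>a(i,j)\<close> with the entry \<open>X\<^sub>b(k,l)\<close> of a letter \<open>b\<close> forces \<open>k = j\<close> and
  \<open>l = i\<close>. The summation indices next to \<open>b\<close> are thereby fixed and the product is cut in two.
\<close>
lemma wick_derivative_word:
  assumes "a \<in> S" "i < d" "j < d" "set w \<subseteq> S" "p < d" "q < d"
  shows "wick_derivative (X a i j) (word_entry w p q)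
    (\<lambda>\<omega>. \<Sum>m<length w. contraction a w m * (word_entry (take m w) p j \<omega> * word_entry (drop (Suc m) w) i q \<omega>))"
  using assms(4,5)
proof (induction w arbitrary: p)
  case Nil
  show ?case
    by (rule wick_derivative_cong[OF wick_derivative_const[where c = "if p = q then 1 else 0"]]) auto
next
  case (Cons b w)
  let ?g = "X a i j"
  let ?D = "\<lambda>k \<omega>. \<Sum>m<length w. contraction a w m * (word_entry (take m w) k j \<omega> * word_entry (drop (Suc m) w) i q \<omega>)"
  have "wick_derivative ?g (\<lambda>\<omega>. \<Sum>k<d. X b p k \<omega> * word_entry w k q \<omega>)
     (\<lambda>\<omega>. \<Sum>k<d. expectation (\<lambda>\<omega>. ?g \<omega> * X b p k \<omega>) * word_entry w k q \<omega> + X b p k \<omega> * ?D k \<omega>)"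
    using Cons assms
    by (intro wick_derivative_sum wick_derivative_mult wick_derivative_complexification entry_all_moments entry Cons.IH)
       auto
  note D = this
  have eq: "(\<Sum>k<d. expectation (\<lambda>\<omega>. ?g \<omega> * X b p k \<omega>) * word_entry w k q \<omega> + X b p k \<omega> * ?D k \<omega>) =
    (\<Sum>m<length (b # w). contraction a (b # w) m *
      (word_entry (take m (b # w)) p j \<omega> * word_entry (drop (Suc m) (b # w)) i q \<omega>))" for \<omega>
  proof -
    have "(\<Sum>k<d. expectation (\<lambda>\<omega>. ?g \<omega> * X b p k \<omega>) * word_entry w k q \<omega>) =
      (\<Sum>k<d. if k = i then (if j = p then of_real (c a b) / of_nat d * word_entry w i q \<omega> else 0) else 0)"
      using Cons.prems assms by (intro sum.cong refl) (auto simp: covariance)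
    also have "\<dots> = contraction a (b # w) 0 * (word_entry [] p j \<omega> * word_entry w i q \<omega>)"
      using assms by (simp add: contraction_def)
    finally have first: "(\<Sum>k<d. expectation (\<lambda>\<omega>. ?g \<omega> * X b p k \<omega>) * word_entry w k q \<omega>) =
      contraction a (b # w) 0 * (word_entry [] p j \<omega> * word_entry w i q \<omega>)" .
    have "(\<Sum>k<d. X b p k \<omega> * ?D k \<omega>) =
      (\<Sum>m<length w. \<Sum>k<d. X b p k \<omega> * (contraction a w m * (word_entry (take m w) k j \<omega> * word_entry (drop (Suc m) w) i q \<omega>)))"
      by (simp only: sum_distrib_left) (rule sum.swap)
    also have "\<dots> = (\<Sum>m<length w. contraction a (b # w) (Suc m) *
      (word_entry (b # take m w) p j \<omega> * word_entry (drop (Suc m) w) i q \<omega>))"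
      by (simp add: sum_distrib_left sum_distrib_right contraction_def mult_ac)
    finally show ?thesis
      unfolding sum.distrib first by (simp del: sum.lessThan_Suc word_entry.simps add: sum.lessThan_Suc_shift)
  qed
  show ?case
    by (rule wick_derivative_cong[OF D]) (simp_all only: eq word_entry.simps)
qed

text \<open>
  In a trace the two pieces of the cut word are joined again cyclically at the other end.
\<close>
lemma wick_derivative_trace:
  assumes "a \<in> S" "i < d" "j < d" "set w \<subseteq> S"
  shows "wick_derivative (X a i j) (trace w)
    (\<lambda>\<omega>. \<Sum>m<length w. contraction a w m * word_entry (drop (Suc m) w @ take m w) i j \<omega>)"
proof -
  have "wick_derivative (X a i j) (\<lambda>\<omega>. \<Sum>p<d. word_entry w p p \<omega>)
     (\<lambda>\<omega>. \<Sum>p<d. \<Sum>m<length w. contraction a w m * (word_entry (take m w) p j \<omega> * word_entry (drop (Suc m) w) i p \<omega>))"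
    using assms by (intro wick_derivative_sum wick_derivative_word) auto
  note D = this
  have eq: "(\<Sum>p<d. \<Sum>m<length w. contraction a w m * (word_entry (take m w) p j \<omega> * word_entry (drop (Suc m) w) i p \<omega>)) =
    (\<Sum>m<length w. contraction a w m * word_entry (drop (Suc m) w @ take m w) i j \<omega>)" for \<omega>
    using assms by (subst sum.swap) (simp add: word_append sum_distrib_left mult_ac)
  show ?thesis
    by (rule wick_derivative_cong[OF D]) (simp_all only: eq trace_def)
qed

definition traces :: "'t list list \<Rightarrow> 'a \<Rightarrow> complex" where
  "traces ws \<omega> = (\<Prod>w\<leftarrow>ws. trace w \<omega>)"

lemma traces_simps: "traces [] \<omega> = 1" "traces (w # ws) \<omega> = trace w \<omega> * traces ws \<omega>"
  by (simp_all add: traces_def)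

lemma traces_all_moments: "(\<And>w. w \<in> set ws \<Longrightarrow> set w \<subseteq> S) \<Longrightarrow> all_moments (traces ws)"
proof (induction ws)
  case Nil
  then show ?case by (simp add: traces_def all_moments_const)
next
  case (Cons w ws)
  then show ?case by (auto simp: traces_def intro!: all_moments_mult trace_all_moments)
qed

lemma wick_derivative_traces:
  assumes "a \<in> S" "i < d" "j < d" "\<And>w. w \<in> set ws \<Longrightarrow> set w \<subseteq> S"
  shows "wick_derivative (X a i j) (traces ws)
    (\<lambda>\<omega>. \<Sum>l<length ws. (\<Sum>m<length (ws ! l). contraction a (ws ! l) m *
        word_entry (drop (Suc m) (ws ! l) @ take m (ws ! l)) i j \<omega>) * traces (take l ws @ drop (Suc l) ws) \<omega>)"
  using assms(4)
proof (induction ws)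
  case Nil
  show ?case by (rule wick_derivative_cong[OF wick_derivative_const[where c = 1]]) (auto simp: traces_simps)
next
  case (Cons w ws)
  show ?case
    by (rule wick_derivative_cong[OF wick_derivative_mult[OF wick_derivative_trace Cons.IH]])
       (use Cons.prems assms in \<open>auto simp del: sum.lessThan_Suc simp: traces_simps sum.lessThan_Suc_shift sum_distrib_left mult_ac\<close>)
qed

text \<open>
  Integration by parts for each entry \<open>X\<^sub>a(i,j)\<close> of the first letter, summed over \<open>i\<close> and
  \<open>j\<close>. Pairing within the own word leaves two closed cycles of indices, i.e. two traces, whereas
  pairing with a letter of another trace joins two cycles into one.
\<close>
theorem schwinger_dyson:
  assumes a: "a \<in> S" and w: "set w \<subseteq> S" and ball_ws: "\<forall>v\<in>set ws. set v \<subseteq> S"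
  shows "expectation (traces ((a # w) # ws)) =
    (\<Sum>m<length w. contraction a w m * expectation (traces (take m w # drop (Suc m) w # ws)))
    + (\<Sum>l<length ws. \<Sum>m<length (ws ! l). contraction a (ws ! l) m *
        expectation (traces ((w @ drop (Suc m) (ws ! l) @ take m (ws ! l)) # take l ws @ drop (Suc l) ws)))"
proof -
  note ws = bspec[OF ball_ws]
  \<comment> \<open>\<open>?P\<close> is the derivative of the first word, \<open>?Q\<close> that of the remaining traces.\<close>
  let ?P = "\<lambda>i j \<omega>. \<Sum>m<length w. contraction a w m * (word_entry (take m w) j j \<omega> * word_entry (drop (Suc m) w) i i \<omega>)"
  let ?Q = "\<lambda>i j \<omega>. \<Sum>l<length ws. (\<Sum>m<length (ws ! l). contraction a (ws ! l) m *
        word_entry (drop (Suc m) (ws ! l) @ take m (ws ! l)) i j \<omega>) * traces (take l ws @ drop (Suc l) ws) \<omega>"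
  let ?D = "\<lambda>i j \<omega>. ?P i j \<omega> * traces ws \<omega> + word_entry w j i \<omega> * ?Q i j \<omega>"
  have sub: "set (take m v) \<subseteq> S" "set (drop m v) \<subseteq> S" if "set v \<subseteq> S" for v m
    using that set_take_subset set_drop_subset by fast+
  have wsl: "set (ws ! l) \<subseteq> S" if "l < length ws" for l
    using ws that by simp
  have rest: "set v \<subseteq> S" if "v \<in> set (take l ws @ drop (Suc l) ws)" for v l
    using that ws by (auto dest!: in_set_takeD in_set_dropD)
  have ij: "expectation (\<lambda>\<omega>. X a i j \<omega> * (word_entry w j i \<omega> * traces ws \<omega>)) = expectation (?D i j)"
    and intij: "integrable M (\<lambda>\<omega>. X a i j \<omega> * (word_entry w j i \<omega> * traces ws \<omega>))" "integrable M (?D i j)"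
    if "i < d" "j < d" for i j
  proof -
    have D: "wick_derivative (X a i j) (\<lambda>\<omega>. word_entry w j i \<omega> * traces ws \<omega>) (?D i j)"
      by (intro wick_derivative_mult wick_derivative_word wick_derivative_traces that a w ws)
    show "expectation (\<lambda>\<omega>. X a i j \<omega> * (word_entry w j i \<omega> * traces ws \<omega>)) = expectation (?D i j)"
      by (intro expectation_wick_derivative D entry a that)
    show "integrable M (?D i j)"
      using wick_derivative_all_moments[OF D] all_moments_integrable by blast
    show "integrable M (\<lambda>\<omega>. X a i j \<omega> * (word_entry w j i \<omega> * traces ws \<omega>))"
      by (intro all_moments_integrable all_moments_mult entry_all_moments word_all_moments traces_all_moments that a w ws)
  qed
  have "expectation (traces ((a # w) # ws)) =
    expectation (\<lambda>\<omega>. \<Sum>i<d. \<Sum>j<d. X a i j \<omega> * (word_entry w j i \<omega> * traces ws \<omega>))"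
    by (intro Bochner_Integration.integral_cong refl)
       (simp add: traces_simps trace_def sum_distrib_right mult.assoc)
  also have "\<dots> = (\<Sum>i<d. \<Sum>j<d. expectation (?D i j))"
    by (subst Bochner_Integration.integral_sum, auto intro!: Bochner_Integration.integrable_sum intij sum.cong)
       (subst Bochner_Integration.integral_sum, auto intro!: intij sum.cong ij)
  also have "\<dots> = expectation (\<lambda>\<omega>. \<Sum>i<d. \<Sum>j<d. ?D i j \<omega>)"
    by (subst Bochner_Integration.integral_sum, auto intro!: Bochner_Integration.integrable_sum intij sum.cong)
       (subst Bochner_Integration.integral_sum, auto intro!: intij sum.cong)
  also have "\<dots> = expectation (\<lambda>\<omega>. (\<Sum>m<length w. contraction a w m * traces (take m w # drop (Suc m) w # ws) \<omega>)
    + (\<Sum>l<length ws. \<Sum>m<length (ws ! l). contraction a (ws ! l) m *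
        traces ((w @ drop (Suc m) (ws ! l) @ take m (ws ! l)) # take l ws @ drop (Suc l) ws) \<omega>))"
  proof (intro Bochner_Integration.integral_cong refl)
    fix \<omega>
    have "(\<Sum>i<d. \<Sum>j<d. ?P i j \<omega> * traces ws \<omega>) =
      (\<Sum>m<length w. \<Sum>i<d. \<Sum>j<d. contraction a w m * (word_entry (take m w) j j \<omega> * word_entry (drop (Suc m) w) i i \<omega>) * traces ws \<omega>)"
      by (simp only: sum_distrib_right sum.swap[of _ "{..<length w}"])
    also have "\<dots> = (\<Sum>m<length w. contraction a w m * traces (take m w # drop (Suc m) w # ws) \<omega>)"
    proof (intro sum.cong refl)
      fix m
      have "(\<Sum>i<d. \<Sum>j<d. contraction a w m * (word_entry (take m w) j j \<omega> * word_entry (drop (Suc m) w) i i \<omega>) * traces ws \<omega>) =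
        contraction a w m * ((\<Sum>i<d. \<Sum>j<d. word_entry (drop (Suc m) w) i i \<omega> * word_entry (take m w) j j \<omega>) * traces ws \<omega>)"
        by (simp add: sum_distrib_left sum_distrib_right mult_ac)
      also have "(\<Sum>i<d. \<Sum>j<d. word_entry (drop (Suc m) w) i i \<omega> * word_entry (take m w) j j \<omega>) =
        trace (drop (Suc m) w) \<omega> * trace (take m w) \<omega>"
        by (simp only: trace_def sum_product)
      finally show "(\<Sum>i<d. \<Sum>j<d. contraction a w m * (word_entry (take m w) j j \<omega> * word_entry (drop (Suc m) w) i i \<omega>) * traces ws \<omega>) =
        contraction a w m * traces (take m w # drop (Suc m) w # ws) \<omega>"
        by (simp add: traces_simps mult_ac)
    qed
    finally have P: "(\<Sum>i<d. \<Sum>j<d. ?P i j \<omega> * traces ws \<omega>) =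
      (\<Sum>m<length w. contraction a w m * traces (take m w # drop (Suc m) w # ws) \<omega>)" .
    have "(\<Sum>i<d. \<Sum>j<d. word_entry w j i \<omega> * ?Q i j \<omega>) =
      (\<Sum>l<length ws. \<Sum>m<length (ws ! l). \<Sum>i<d. \<Sum>j<d. contraction a (ws ! l) m *
        (word_entry w j i \<omega> * word_entry (drop (Suc m) (ws ! l) @ take m (ws ! l)) i j \<omega>) * traces (take l ws @ drop (Suc l) ws) \<omega>)"
      unfolding sum_distrib_left sum_distrib_right mult.assoc sum.swap[of _ "{..<length ws}"]
    proof (rule sum.cong[OF refl])
      fix l
      show "(\<Sum>i<d. \<Sum>j<d. \<Sum>m<length (ws ! l). word_entry w j i \<omega> * (contraction a (ws ! l) m *
          (word_entry (drop (Suc m) (ws ! l) @ take m (ws ! l)) i j \<omega> * traces (take l ws @ drop (Suc l) ws) \<omega>))) =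
        (\<Sum>m<length (ws ! l). \<Sum>i<d. \<Sum>j<d. contraction a (ws ! l) m *
          (word_entry w j i \<omega> * (word_entry (drop (Suc m) (ws ! l) @ take m (ws ! l)) i j \<omega> * traces (take l ws @ drop (Suc l) ws) \<omega>)))"
        by (simp only: sum.swap[of _ "{..<length (ws ! l)}"] mult.left_commute[of "word_entry w _ _ \<omega>"])
    qed
    also have "\<dots> = (\<Sum>l<length ws. \<Sum>m<length (ws ! l). contraction a (ws ! l) m *
        traces ((w @ drop (Suc m) (ws ! l) @ take m (ws ! l)) # take l ws @ drop (Suc l) ws) \<omega>)"
    proof (intro sum.cong refl)
      fix l m
      let ?v = "drop (Suc m) (ws ! l) @ take m (ws ! l)" and ?r = "take l ws @ drop (Suc l) ws"
      have "(\<Sum>i<d. \<Sum>j<d. contraction a (ws ! l) m * (word_entry w j i \<omega> * word_entry ?v i j \<omega>) * traces ?r \<omega>) =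
         contraction a (ws ! l) m * ((\<Sum>i<d. \<Sum>j<d. word_entry w j i \<omega> * word_entry ?v i j \<omega>) * traces ?r \<omega>)"
        by (simp only: sum_distrib_left sum_distrib_right mult.assoc)
      also have "(\<Sum>i<d. \<Sum>j<d. word_entry w j i \<omega> * word_entry ?v i j \<omega>) = trace (w @ ?v) \<omega>"
        by (subst sum.swap) (simp only: trace_append)
      finally show "(\<Sum>i<d. \<Sum>j<d. contraction a (ws ! l) m * (word_entry w j i \<omega> * word_entry ?v i j \<omega>) * traces ?r \<omega>) =
        contraction a (ws ! l) m * traces ((w @ ?v) # ?r) \<omega>"
        by (simp only: traces_simps)
    qed
    finally have Q: "(\<Sum>i<d. \<Sum>j<d. word_entry w j i \<omega> * ?Q i j \<omega>) =
      (\<Sum>l<length ws. \<Sum>m<length (ws ! l). contraction a (ws ! l) m *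
        traces ((w @ drop (Suc m) (ws ! l) @ take m (ws ! l)) # take l ws @ drop (Suc l) ws) \<omega>)" .
    show "(\<Sum>i<d. \<Sum>j<d. ?D i j \<omega>) = (\<Sum>m<length w. contraction a w m * traces (take m w # drop (Suc m) w # ws) \<omega>)
    + (\<Sum>l<length ws. \<Sum>m<length (ws ! l). contraction a (ws ! l) m *
        traces ((w @ drop (Suc m) (ws ! l) @ take m (ws ! l)) # take l ws @ drop (Suc l) ws) \<omega>)"
      by (simp only: sum.distrib P Q)
  qed
  also have "\<dots> = (\<Sum>m<length w. contraction a w m * expectation (traces (take m w # drop (Suc m) w # ws)))
    + (\<Sum>l<length ws. \<Sum>m<length (ws ! l). contraction a (ws ! l) m *
        expectation (traces ((w @ drop (Suc m) (ws ! l) @ take m (ws ! l)) # take l ws @ drop (Suc l) ws)))"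
  proof -
    have i1: "integrable M (traces (take m w # drop (Suc m) w # ws))" for m
      using ws by (intro all_moments_integrable traces_all_moments) (metis set_ConsD sub w)
    have i2: "integrable M (traces ((w @ drop (Suc m) (ws ! l) @ take m (ws ! l)) # take l ws @ drop (Suc l) ws))"
      if "l < length ws" for l m
    proof (intro all_moments_integrable traces_all_moments)
      fix v assume "v \<in> set ((w @ drop (Suc m) (ws ! l) @ take m (ws ! l)) # take l ws @ drop (Suc l) ws)"
      then consider "v = w @ drop (Suc m) (ws ! l) @ take m (ws ! l)" | "v \<in> set (take l ws @ drop (Suc l) ws)"
        by auto
      then show "set v \<subseteq> S"
        using rest[of v l] by cases (simp_all add: sub wsl that w)
    qed
    show ?thesis
      by (subst Bochner_Integration.integral_add)
         (auto intro!: Bochner_Integration.integrable_sum integrable_mult_right i1 i2 arg_cong2[of _ _ _ _ "(+)"]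
            simp: Bochner_Integration.integral_sum i1 i2)
  qed
  finally show ?thesis .
qed

definition normalized_moment :: "'t list list \<Rightarrow> complex" where
  "normalized_moment ws = expectation (traces ws) / of_nat d ^ length ws"

lemma normalized_moment_Nil: "normalized_moment [] = 1"
  by (simp add: normalized_moment_def traces_def[abs_def] prob_space)

lemma normalized_moment_empty_word: "normalized_moment ([] # ws) = normalized_moment ws"
  using d_pos by (simp add: normalized_moment_def traces_def[abs_def] trace_def)

text \<open>
  A splitting produces one trace more, which compensates the factor \<open>1/d\<close> of the covariance; a
  merging produces one trace less, so that \<open>1/d\<^sup>2\<close> is left.
\<close>
lemma normalized_moment_rec:
  assumes "a \<in> S" and "set w \<subseteq> S" and "\<forall>v\<in>set ws. set v \<subseteq> S"
  shows "normalized_moment ((a # w) # ws) =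
    (\<Sum>m<length w. of_real (c a (w ! m)) * normalized_moment (take m w # drop (Suc m) w # ws))
    + (\<Sum>l<length ws. \<Sum>m<length (ws ! l). of_real (c a (ws ! l ! m)) *
        normalized_moment ((w @ drop (Suc m) (ws ! l) @ take m (ws ! l)) # take l ws @ drop (Suc l) ws)) / of_nat d ^ 2"
proof -
  define n where "n = length ws"
  have d: "of_nat d \<noteq> (0::complex)" using d_pos by simp
  have 1: "contraction a w m * expectation (traces (take m w # drop (Suc m) w # ws)) / of_nat d ^ Suc n =
     of_real (c a (w ! m)) * normalized_moment (take m w # drop (Suc m) w # ws)" for m
    using d by (simp add: contraction_def normalized_moment_def n_def)
  have 2: "contraction a (ws ! l) m * E / of_nat d ^ Suc n =
    of_real (c a (ws ! l ! m)) * (E / of_nat d ^ n) / of_nat d ^ 2" for l m E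
    using d by (simp add: contraction_def power2_eq_square)
  have len: "length ((w @ drop (Suc m) (ws ! l) @ take m (ws ! l)) # take l ws @ drop (Suc l) ws) = n" if "l < n" for l m
    using that by (simp add: n_def)
  show ?thesis
    unfolding normalized_moment_def[of "(a # w) # ws"] schwinger_dyson[OF assms] add_divide_distrib
  proof (intro arg_cong2[of _ _ _ _ "(+)"])
    show "(\<Sum>m<length w. contraction a w m * expectation (traces (take m w # drop (Suc m) w # ws))) / of_nat d ^ length ((a # w) # ws) =
      (\<Sum>m<length w. of_real (c a (w ! m)) * normalized_moment (take m w # drop (Suc m) w # ws))"
      by (simp only: sum_divide_distrib length_Cons n_def[symmetric] 1)
    show "(\<Sum>l<length ws. \<Sum>m<length (ws ! l). contraction a (ws ! l) m *
        expectation (traces ((w @ drop (Suc m) (ws ! l) @ take m (ws ! l)) # take l ws @ drop (Suc l) ws)))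
        / of_nat d ^ length ((a # w) # ws) =
      (\<Sum>l<length ws. \<Sum>m<length (ws ! l). of_real (c a (ws ! l ! m)) *
        normalized_moment ((w @ drop (Suc m) (ws ! l) @ take m (ws ! l)) # take l ws @ drop (Suc l) ws)) / of_nat d ^ 2"
      unfolding sum_divide_distrib length_Cons n_def[symmetric] 2
      by (intro sum.cong refl) (simp only: normalized_moment_def len lessThan_iff)
  qed
qed

end

lemma (in hermitian_gaussian_matrices) mean_trace_eq_normalized_moment:
  assumes dim: "\<And>s \<omega>. A s \<omega> \<in> carrier_mat d d"
    and entries: "\<And>s i j \<omega>. i < d \<Longrightarrow> j < d \<Longrightarrow> A s \<omega> $$ (i, j) = X s i j \<omega>"
  shows "mean_trace d (\<lambda>\<omega>. mat_prod_list d (map (\<lambda>s. A s \<omega>) w)) = normalized_moment [w]"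
proof -
  have "mat_prod_list d (map (\<lambda>s. A s \<omega>) w) \<in> carrier_mat d d \<and>
    (\<forall>i<d. \<forall>j<d. mat_prod_list d (map (\<lambda>s. A s \<omega>) w) $$ (i, j) = word_entry w i j \<omega>)" for \<omega>
  proof (induction w)
    case Nil
    show ?case by (simp add: mat_prod_list_def)
  next
    case (Cons s w)
    let ?P = "mat_prod_list d (map (\<lambda>s. A s \<omega>) w)"
    have eq: "mat_prod_list d (map (\<lambda>s. A s \<omega>) (s # w)) = A s \<omega> * ?P"
      by (simp add: mat_prod_list_def)
    have P: "?P \<in> carrier_mat d d" using Cons by blast
    have "(A s \<omega> * ?P) $$ (i, j) = (\<Sum>k<d. X s i k \<omega> * word_entry w k j \<omega>)" if "i < d" "j < d" for i j
    proof -
      have "(A s \<omega> * ?P) $$ (i, j) = (\<Sum>k\<in>{0..<d}. A s \<omega> $$ (i, k) * ?P $$ (k, j))"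
        using dim[of s \<omega>] P that by (simp add: scalar_prod_def)
      also have "\<dots> = (\<Sum>k<d. X s i k \<omega> * word_entry w k j \<omega>)"
        using Cons that by (intro sum.cong) (auto simp: entries)
      finally show ?thesis .
    qed
    then show ?case unfolding eq using mult_carrier_mat[OF dim P] by simp
  qed
  then have "(\<Sum>i<d. mat_prod_list d (map (\<lambda>s. A s \<omega>) w) $$ (i, i)) = traces [w] \<omega>" for \<omega>
    by (simp add: traces_simps trace_def)
  then show ?thesis by (simp add: mean_trace_def normalized_moment_def)
qed


section \<open>The limit of large dimension\<close>

text \<open>
  For a covariance kernel \<open>c\<close>, the mixed moments of the semicircular family with covariance \<open>c\<close> in free probability, by the
  recursion that remains of the Schwinger--Dyson equation when mergings are dropped.
\<close>
fun free_moment :: "('t \<Rightarrow> 't \<Rightarrow> real) \<Rightarrow> 't list \<Rightarrow> real" where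
  "free_moment c [] = 1"
| "free_moment c (a # w) =
    (\<Sum>m<length w. c a (w ! m) * (free_moment c (take m w) * free_moment c (drop (Suc m) w)))"

text \<open>
  Induction on the total length of the words, where each word counts one more than its length so that
  empty words can be removed too. The terms from mergings converge by induction as well and are
  multiplied by \<open>1/d\<^sup>2\<close>, hence vanish in the limit.
\<close>
lemma tendsto_free_moments:
  fixes T :: "nat \<Rightarrow> 't list list \<Rightarrow> complex"
  assumes Nil: "\<And>d. 0 < d \<Longrightarrow> T d [] = 1"
    and empty_word: "\<And>d ws. 0 < d \<Longrightarrow> T d ([] # ws) = T d ws"
    and rec: "\<And>d a w ws. 0 < d \<Longrightarrow> a \<in> S \<Longrightarrow> set w \<subseteq> S \<Longrightarrow> \<forall>v\<in>set ws. set v \<subseteq> S \<Longrightarrow>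
      T d ((a # w) # ws) =
      (\<Sum>m<length w. of_real (c a (w ! m)) * T d (take m w # drop (Suc m) w # ws))
      + (\<Sum>l<length ws. \<Sum>m<length (ws ! l). of_real (c a (ws ! l ! m)) *
          T d ((w @ drop (Suc m) (ws ! l) @ take m (ws ! l)) # take l ws @ drop (Suc l) ws)) / of_nat d ^ 2"
    and "\<forall>v\<in>set ws. set v \<subseteq> S"
  shows "(\<lambda>d. T d ws) \<longlonglongrightarrow> of_real (\<Prod>w\<leftarrow>ws. free_moment c w)"
  using assms(4)
proof (induction "\<Sum>w\<leftarrow>ws. Suc (length w)" arbitrary: ws rule: less_induct)
  case less
  note IH = less.hyps
  consider "ws = []" | us where "ws = [] # us" | a w us where "ws = (a # w) # us"
    by (metis list.exhaust)
  then show ?case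
  proof cases
    case 1
    have "eventually (\<lambda>d. T d ws = 1) sequentially"
      using eventually_gt_at_top[of 0] by eventually_elim (simp add: 1 Nil)
    then show ?thesis by (simp add: 1 tendsto_eventually)
  next
    case 2
    have "(\<lambda>d. T d us) \<longlonglongrightarrow> of_real (\<Prod>w\<leftarrow>us. free_moment c w)"
      using less.prems by (intro IH) (simp_all add: 2)
    moreover have "eventually (\<lambda>d. T d us = T d ws) sequentially"
      using eventually_gt_at_top[of 0] by eventually_elim (simp add: 2 empty_word)
    ultimately show ?thesis by (simp add: 2 Lim_transform_eventually)
  next
    case 3
    have S: "a \<in> S" "set w \<subseteq> S" "\<forall>v\<in>set us. set v \<subseteq> S" using less.prems by (auto simp: 3)
    let ?split = "\<lambda>m. take m w # drop (Suc m) w # us"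
    let ?merge = "\<lambda>l m. (w @ drop (Suc m) (us ! l) @ take m (us ! l)) # take l us @ drop (Suc l) us"
    have split: "(\<lambda>d. T d (?split m)) \<longlonglongrightarrow> of_real (\<Prod>w\<leftarrow>?split m. free_moment c w)" if "m < length w" for m
    proof (rule IH)
      show "\<forall>v\<in>set (?split m). set v \<subseteq> S"
        using S by (auto dest: in_set_takeD in_set_dropD)
    qed (use that in \<open>simp add: 3\<close>)
    have merge: "(\<lambda>d. T d (?merge l m)) \<longlonglongrightarrow> of_real (\<Prod>w\<leftarrow>?merge l m. free_moment c w)"
      if l: "l < length us" and m: "m < length (us ! l)" for l m
    proof (rule IH)
      have "set (us ! l) \<subseteq> S" using S l by simp
      then show "\<forall>v\<in>set (?merge l m). set v \<subseteq> S"
        using S by (auto dest: in_set_takeD in_set_dropD)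
      have "(\<Sum>w\<leftarrow>us. Suc (length w)) = (\<Sum>w\<leftarrow>take l us @ us ! l # drop (Suc l) us. Suc (length w))"
        using id_take_nth_drop[OF l] by simp
      then show "(\<Sum>w\<leftarrow>?merge l m. Suc (length w)) < (\<Sum>w\<leftarrow>ws. Suc (length w))"
        using m by (simp add: 3)
    qed
    have lim: "(\<lambda>d. (\<Sum>m<length w. of_real (c a (w ! m)) * T d (?split m))
      + (\<Sum>l<length us. \<Sum>m<length (us ! l). of_real (c a (us ! l ! m)) * T d (?merge l m)) * (1 / of_nat d) ^ 2)
      \<longlonglongrightarrow> (\<Sum>m<length w. of_real (c a (w ! m)) * of_real (\<Prod>w\<leftarrow>?split m. free_moment c w))
      + (\<Sum>l<length us. \<Sum>m<length (us ! l). of_real (c a (us ! l ! m)) *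
          of_real (\<Prod>w\<leftarrow>?merge l m. free_moment c w)) * 0 ^ 2"
      by (intro tendsto_add tendsto_mult tendsto_sum tendsto_const tendsto_power split merge lim_1_over_n) auto
    have ev: "eventually (\<lambda>d. (\<Sum>m<length w. of_real (c a (w ! m)) * T d (?split m))
      + (\<Sum>l<length us. \<Sum>m<length (us ! l). of_real (c a (us ! l ! m)) * T d (?merge l m)) * (1 / of_nat d) ^ 2
      = T d ws) sequentially"
      using eventually_gt_at_top[of 0]
      by eventually_elim (simp add: 3 rec[OF _ S] power_divide)
    have eq: "(\<Sum>m<length w. of_real (c a (w ! m)) * of_real (\<Prod>w\<leftarrow>?split m. free_moment c w))
      + (\<Sum>l<length us. \<Sum>m<length (us ! l). of_real (c a (us ! l ! m)) *
          of_real (\<Prod>w\<leftarrow>?merge l m. free_moment c w)) * 0 ^ 2 = complex_of_real (\<Prod>w\<leftarrow>ws. free_moment c w)"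
      by (simp add: 3 sum_distrib_right mult.assoc)
    show ?thesis by (rule Lim_transform_eventually[OF lim ev, unfolded eq])
  qed
qed

lemma tendsto_normalized_moment:
  assumes L: "\<And>d. 0 < d \<Longrightarrow> hermitian_gaussian_matrices M (V d) d S c (X d)" and "set w \<subseteq> S"
  shows "(\<lambda>d. hermitian_gaussian_matrices.normalized_moment M d (X d) [w]) \<longlonglongrightarrow> of_real (free_moment c w)"
proof -
  have "(\<lambda>d. hermitian_gaussian_matrices.normalized_moment M d (X d) [w]) \<longlonglongrightarrow>
    of_real (\<Prod>w\<leftarrow>[w]. free_moment c w)"
  proof (rule tendsto_free_moments[where S = S])
    show "\<forall>v\<in>set [w]. set v \<subseteq> S" using assms(2) by simp
  qed (rule hermitian_gaussian_matrices.normalized_moment_Nil[OF L]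
      hermitian_gaussian_matrices.normalized_moment_empty_word[OF L]
      hermitian_gaussian_matrices.normalized_moment_rec[OF L]; assumption)+
  then show ?thesis by simp
qed


section \<open>Sums over non-crossing pairings\<close>

text \<open>
  Pairings of arbitrary sets of points, as the points between the two ends of a block do not start at
  \<open>1\<close>.
\<close>
definition nc_pairings_on :: "nat set \<Rightarrow> nat set set set" where
  "nc_pairings_on A =
     {\<pi>. partition_on A \<pi> \<and> (\<forall>b\<in>\<pi>. card b = 2) \<and>
         \<not> (\<exists>p q p' q'. p < q \<and> q < p' \<and> p' < q' \<and> {p, p'} \<in> \<pi> \<and> {q, q'} \<in> \<pi>)}"

lemma noncrossing_pairings_eq: "noncrossing_pairings r = nc_pairings_on {1..<r + 1}"
  unfolding noncrossing_pairings_def nc_pairings_on_def by (simp add: atLeastLessThanSuc_atLeastAtMost)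

lemma nc_pairings_onD:
  assumes "\<pi> \<in> nc_pairings_on A"
  shows "\<Union>\<pi> = A" "{} \<notin> \<pi>" "disjoint \<pi>" "\<forall>\<beta>\<in>\<pi>. card \<beta> = 2"
  using assms by (simp_all add: nc_pairings_on_def partition_on_def)

lemma nc_pairings_on_noncrossing:
  assumes "\<pi> \<in> nc_pairings_on A" "p < q" "q < p'" "p' < q'" "{p, p'} \<in> \<pi>" "{q, q'} \<in> \<pi>"
  shows False
  using assms unfolding nc_pairings_on_def by blast

lemma nc_pairings_onI:
  assumes "partition_on A \<pi>" "\<forall>\<beta>\<in>\<pi>. card \<beta> = 2"
    and "\<And>p q p' q'. p < q \<Longrightarrow> q < p' \<Longrightarrow> p' < q' \<Longrightarrow> {p, p'} \<in> \<pi> \<Longrightarrow> {q, q'} \<in> \<pi> \<Longrightarrow> False"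
  shows "\<pi> \<in> nc_pairings_on A"
  unfolding nc_pairings_on_def mem_Collect_eq
proof (intro conjI notI)
  assume "\<exists>p q p' q'. p < q \<and> q < p' \<and> p' < q' \<and> {p, p'} \<in> \<pi> \<and> {q, q'} \<in> \<pi>"
  then show False by (elim exE conjE) (rule assms(3))
qed (use assms(1,2) in simp_all)

lemma nc_pairings_on_finite: "finite A \<Longrightarrow> finite (nc_pairings_on A)"
  by (rule finite_subset[of _ "Pow (Pow A)"]) (auto simp: nc_pairings_on_def partition_on_def)

lemma nc_pairings_on_empty: "nc_pairings_on {} = {{}}"
  by (auto simp: nc_pairings_on_def partition_on_def)

lemma nc_pairings_on_odd:
  assumes "odd (card A)" "finite A"
  shows "nc_pairings_on A = {}"
proof -
  have "even (card A)" if "\<pi> \<in> nc_pairings_on A" for \<pi>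
  proof -
    have P: "partition_on A \<pi>" and two: "\<forall>b\<in>\<pi>. card b = 2" using that by (auto simp: nc_pairings_on_def)
    have "2 * card \<pi> = card (\<Union>\<pi>)"
    proof (rule card_partition)
      show "finite \<pi>" using finite_elements[OF assms(2) P] .
      show "finite (\<Union>\<pi>)" using P assms(2) by (simp add: partition_on_def)
    qed (use P two in \<open>auto simp: partition_on_def disjoint_def\<close>)
    then show ?thesis using P by (metis dvd_triv_left partition_onD1)
  qed
  then show ?thesis using assms(1) by blast
qed

lemma nc_pairings_on_block:
  assumes "\<pi> \<in> nc_pairings_on A" "\<beta> \<in> \<pi>"
  obtains p q where "p < q" "\<beta> = {p, q}" "p \<in> A" "q \<in> A"
proof -
  have "card \<beta> = 2" "\<beta> \<subseteq> A" using nc_pairings_onD(1,4)[OF assms(1)] assms(2) by blast+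
  then obtain p q where "p \<noteq> q" "\<beta> = {p, q}" by (auto simp: card_2_iff)
  then show ?thesis
    using that[of p q] that[of q p] \<open>\<beta> \<subseteq> A\<close> by (cases "p < q") (auto simp: insert_commute)
qed

lemma nc_pairings_on_restrict:
  assumes \<pi>: "\<pi> \<in> nc_pairings_on A" and B: "B \<subseteq> A"
    and sat: "\<And>\<beta>. \<beta> \<in> \<pi> \<Longrightarrow> \<beta> \<inter> B \<noteq> {} \<Longrightarrow> \<beta> \<subseteq> B"
  shows "{\<beta> \<in> \<pi>. \<beta> \<subseteq> B} \<in> nc_pairings_on B"
proof -
  have "\<Union>{\<beta> \<in> \<pi>. \<beta> \<subseteq> B} = B"
  proof (intro equalityI subsetI)
    fix x assume "x \<in> B"
    then obtain \<beta> where "\<beta> \<in> \<pi>" "x \<in> \<beta>"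
      using nc_pairings_onD(1)[OF \<pi>] B by blast
    then show "x \<in> \<Union>{\<beta> \<in> \<pi>. \<beta> \<subseteq> B}" using sat \<open>x \<in> B\<close> by blast
  qed auto
  then have "partition_on B {\<beta> \<in> \<pi>. \<beta> \<subseteq> B}"
    using nc_pairings_onD(2,3)[OF \<pi>] by (simp add: partition_on_def disjoint_def)
  then show ?thesis
    using nc_pairings_onD(4)[OF \<pi>] nc_pairings_on_noncrossing[OF \<pi>] by (intro nc_pairings_onI) auto
qed

lemma nc_pairings_on_join:
  assumes k: "a < k" "k < b"
    and 1: "\<pi>\<^sub>1 \<in> nc_pairings_on {a + 1..<k}" and 2: "\<pi>\<^sub>2 \<in> nc_pairings_on {k + 1..<b}"
  shows "insert {a, k} (\<pi>\<^sub>1 \<union> \<pi>\<^sub>2) \<in> nc_pairings_on {a..<b}"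
proof -
  note U1 = nc_pairings_onD(1)[OF 1] and U2 = nc_pairings_onD(1)[OF 2]
  have B1: "\<beta> \<subseteq> {a + 1..<k}" if "\<beta> \<in> \<pi>\<^sub>1" for \<beta> using that U1 by blast
  have B2: "\<beta> \<subseteq> {k + 1..<b}" if "\<beta> \<in> \<pi>\<^sub>2" for \<beta> using that U2 by blast
  have "partition_on {a..<b} (insert {a, k} (\<pi>\<^sub>1 \<union> \<pi>\<^sub>2))"
  proof (rule partition_onI)
    show "\<Union> (insert {a, k} (\<pi>\<^sub>1 \<union> \<pi>\<^sub>2)) = {a..<b}" using U1 U2 k by auto
    show "{} \<notin> insert {a, k} (\<pi>\<^sub>1 \<union> \<pi>\<^sub>2)"
      using nc_pairings_onD(2)[OF 1] nc_pairings_onD(2)[OF 2] by simp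
    note d1 = nc_pairings_onD(3)[OF 1] and d2 = nc_pairings_onD(3)[OF 2]
    have sep: "{a, k} \<inter> {a + 1..<k} = {}" "{a, k} \<inter> {k + 1..<b} = {}" "{a + 1..<k} \<inter> {k + 1..<b} = {}"
      using k by auto
    have i1: "{a, k} \<inter> \<beta> = {}" if "\<beta> \<in> \<pi>\<^sub>1" for \<beta> using B1[OF that] sep(1) by blast
    have i2: "{a, k} \<inter> \<beta> = {}" if "\<beta> \<in> \<pi>\<^sub>2" for \<beta> using B2[OF that] sep(2) by blast
    have i3: "\<beta> \<inter> \<gamma> = {}" if "\<beta> \<in> \<pi>\<^sub>1" "\<gamma> \<in> \<pi>\<^sub>2" for \<beta> \<gamma> using B1[OF that(1)] B2[OF that(2)] sep(3) by blast
    fix \<beta> \<gamma> assume \<beta>: "\<beta> \<in> insert {a, k} (\<pi>\<^sub>1 \<union> \<pi>\<^sub>2)" and \<gamma>: "\<gamma> \<in> insert {a, k} (\<pi>\<^sub>1 \<union> \<pi>\<^sub>2)" and ne: "\<beta> \<noteq> \<gamma>"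
    have "\<beta> \<inter> \<gamma> = {}"
      using \<beta>
    proof (elim insertE UnE)
      assume "\<beta> = {a, k}"
      then show ?thesis using \<gamma> ne i1 i2 by blast
    next
      assume b: "\<beta> \<in> \<pi>\<^sub>1"
      then have "\<gamma> \<in> \<pi>\<^sub>1 \<Longrightarrow> \<beta> \<inter> \<gamma> = {}" using d1 ne by (simp add: disjointD)
      then show ?thesis using \<gamma> i1[OF b] i3[OF b] by (metis Int_commute insertE UnE)
    next
      assume b: "\<beta> \<in> \<pi>\<^sub>2"
      then have "\<gamma> \<in> \<pi>\<^sub>2 \<Longrightarrow> \<beta> \<inter> \<gamma> = {}" using d2 ne by (simp add: disjointD)
      then show ?thesis using \<gamma> i2[OF b] i3[OF _ b] by (metis Int_commute insertE UnE)
    qed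
    then show "disjnt \<beta> \<gamma>" by (simp add: disjnt_def)
  qed
  moreover
  have "\<forall>\<beta>\<in>insert {a, k} (\<pi>\<^sub>1 \<union> \<pi>\<^sub>2). card \<beta> = 2"
    using nc_pairings_onD(4)[OF 1] nc_pairings_onD(4)[OF 2] k by auto
  moreover
  have False
    if less: "p < q" "q < p'" "p' < q'"
      and P: "{p, p'} \<in> insert {a, k} (\<pi>\<^sub>1 \<union> \<pi>\<^sub>2)" and Q: "{q, q'} \<in> insert {a, k} (\<pi>\<^sub>1 \<union> \<pi>\<^sub>2)"
    for p q p' q'
  proof -
    note nc = nc_pairings_on_noncrossing[OF 1 less] nc_pairings_on_noncrossing[OF 2 less]
    have cases: "(x = a \<and> y = k) \<or> ({x, y} \<in> \<pi>\<^sub>1 \<and> a < x \<and> y < k) \<or> ({x, y} \<in> \<pi>\<^sub>2 \<and> k < x)"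
      if "{x, y} \<in> insert {a, k} (\<pi>\<^sub>1 \<union> \<pi>\<^sub>2)" "x < y" for x y
      using that B1[of "{x, y}"] B2[of "{x, y}"] k by (auto simp: doubleton_eq_iff)
    have "p < p'" "q < q'" using less by auto
    from cases[OF P this(1)] cases[OF Q this(2)] nc less k show False by fastforce
  qed
  ultimately show ?thesis by (rule nc_pairings_onI)
qed

text \<open>
  A block \<open>{p, q}\<close> with \<open>a < p < k < q\<close> would cross \<open>{a, k}\<close>. Hence each other block lies
  on one side of \<open>k\<close>, and a non-crossing pairing with block \<open>{a, k}\<close> is recovered from its
  restrictions to the two sides.
\<close>
lemma bij_betw_nc_pairings_join:
  assumes k: "a < k" "k < b"
  shows "bij_betw (\<lambda>(\<pi>\<^sub>1, \<pi>\<^sub>2). insert {a, k} (\<pi>\<^sub>1 \<union> \<pi>\<^sub>2))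
    (nc_pairings_on {a + 1..<k} \<times> nc_pairings_on {k + 1..<b})
    {\<pi> \<in> nc_pairings_on {a..<b}. {a, k} \<in> \<pi>}"
proof (rule bij_betw_byWitness[where f' = "\<lambda>\<pi>. ({\<beta> \<in> \<pi>. \<beta> \<subseteq> {a + 1..<k}}, {\<beta> \<in> \<pi>. \<beta> \<subseteq> {k + 1..<b}})"])
  show "\<forall>x\<in>nc_pairings_on {a + 1..<k} \<times> nc_pairings_on {k + 1..<b}.
     (\<lambda>\<pi>. ({\<beta> \<in> \<pi>. \<beta> \<subseteq> {a + 1..<k}}, {\<beta> \<in> \<pi>. \<beta> \<subseteq> {k + 1..<b}}))
      (case x of (\<pi>\<^sub>1, \<pi>\<^sub>2) \<Rightarrow> insert {a, k} (\<pi>\<^sub>1 \<union> \<pi>\<^sub>2)) = x"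
  proof (clarify, intro conjI equalityI subsetI)
    fix \<pi>\<^sub>1 \<pi>\<^sub>2 \<beta>
    assume 1: "\<pi>\<^sub>1 \<in> nc_pairings_on {a + 1..<k}" and 2: "\<pi>\<^sub>2 \<in> nc_pairings_on {k + 1..<b}"
    have B1: "\<beta> \<subseteq> {a + 1..<k} \<and> \<beta> \<noteq> {}" if "\<beta> \<in> \<pi>\<^sub>1" for \<beta>
      using that nc_pairings_onD(1,2)[OF 1] by blast
    have B2: "\<beta> \<subseteq> {k + 1..<b} \<and> \<beta> \<noteq> {}" if "\<beta> \<in> \<pi>\<^sub>2" for \<beta>
      using that nc_pairings_onD(1,2)[OF 2] by blast
    have sep: "{a + 1..<k} \<inter> {k + 1..<b} = {}"
      and ak: "\<not> {a, k} \<subseteq> {a + 1..<k}" "\<not> {a, k} \<subseteq> {k + 1..<b}"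
      by auto
    show "\<beta> \<in> \<pi>\<^sub>1" if "\<beta> \<in> {\<beta> \<in> insert {a, k} (\<pi>\<^sub>1 \<union> \<pi>\<^sub>2). \<beta> \<subseteq> {a + 1..<k}}"
      using that B2[of \<beta>] sep ak by blast
    show "\<beta> \<in> {\<beta> \<in> insert {a, k} (\<pi>\<^sub>1 \<union> \<pi>\<^sub>2). \<beta> \<subseteq> {a + 1..<k}}" if "\<beta> \<in> \<pi>\<^sub>1"
      using that B1[of \<beta>] by auto
    show "\<beta> \<in> \<pi>\<^sub>2" if "\<beta> \<in> {\<beta> \<in> insert {a, k} (\<pi>\<^sub>1 \<union> \<pi>\<^sub>2). \<beta> \<subseteq> {k + 1..<b}}"
      using that B1[of \<beta>] sep ak by blast
    show "\<beta> \<in> {\<beta> \<in> insert {a, k} (\<pi>\<^sub>1 \<union> \<pi>\<^sub>2). \<beta> \<subseteq> {k + 1..<b}}" if "\<beta> \<in> \<pi>\<^sub>2"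
      using that B2[of \<beta>] by auto
  qed
  have dichotomy: "\<beta> = {a, k} \<or> \<beta> \<subseteq> {a + 1..<k} \<or> \<beta> \<subseteq> {k + 1..<b}"
    if \<pi>: "\<pi> \<in> nc_pairings_on {a..<b}" and ak: "{a, k} \<in> \<pi>" and \<beta>: "\<beta> \<in> \<pi>" for \<pi> \<beta>
  proof -
    obtain p q where pq: "p < q" "\<beta> = {p, q}" "p \<in> {a..<b}" "q \<in> {a..<b}"
      using nc_pairings_on_block[OF \<pi> \<beta>] .
    have nc: "\<not> (a < p \<and> p < k \<and> k < q)"
      using nc_pairings_on_noncrossing[OF \<pi> _ _ _ ak, of p q] \<beta> pq(2) by blast
    have "\<beta> \<inter> {a, k} = {}" if "\<beta> \<noteq> {a, k}"
      using disjointD[OF nc_pairings_onD(3)[OF \<pi>] \<beta> ak that] .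
    then have "\<beta> = {a, k} \<or> (p \<noteq> a \<and> p \<noteq> k \<and> q \<noteq> k)"
      unfolding pq(2) by blast
    then show ?thesis
    proof
      assume "p \<noteq> a \<and> p \<noteq> k \<and> q \<noteq> k"
      then have "q < k \<or> k < p" "a < p" using pq nc by auto
      then show ?thesis using pq by auto
    qed simp
  qed
  show "\<forall>\<pi>\<in>{\<pi> \<in> nc_pairings_on {a..<b}. {a, k} \<in> \<pi>}.
     (case ({\<beta> \<in> \<pi>. \<beta> \<subseteq> {a + 1..<k}}, {\<beta> \<in> \<pi>. \<beta> \<subseteq> {k + 1..<b}}) of
       (\<pi>\<^sub>1, \<pi>\<^sub>2) \<Rightarrow> insert {a, k} (\<pi>\<^sub>1 \<union> \<pi>\<^sub>2)) = \<pi>"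
  proof clarify
    fix \<pi> assume \<pi>: "\<pi> \<in> nc_pairings_on {a..<b}" and ak: "{a, k} \<in> \<pi>"
    show "insert {a, k} ({\<beta> \<in> \<pi>. \<beta> \<subseteq> {a + 1..<k}} \<union> {\<beta> \<in> \<pi>. \<beta> \<subseteq> {k + 1..<b}}) = \<pi>"
      using ak dichotomy[OF \<pi> ak] by blast
  qed
  show "(\<lambda>(\<pi>\<^sub>1, \<pi>\<^sub>2). insert {a, k} (\<pi>\<^sub>1 \<union> \<pi>\<^sub>2)) ` (nc_pairings_on {a + 1..<k} \<times> nc_pairings_on {k + 1..<b})
    \<subseteq> {\<pi> \<in> nc_pairings_on {a..<b}. {a, k} \<in> \<pi>}"
    by (clarify, intro conjI nc_pairings_on_join[OF k] insertI1)
  show "(\<lambda>\<pi>. ({\<beta> \<in> \<pi>. \<beta> \<subseteq> {a + 1..<k}}, {\<beta> \<in> \<pi>. \<beta> \<subseteq> {k + 1..<b}})) ` {\<pi> \<in> nc_pairings_on {a..<b}. {a, k} \<in> \<pi>}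
    \<subseteq> nc_pairings_on {a + 1..<k} \<times> nc_pairings_on {k + 1..<b}"
  proof (clarify, intro conjI)
    fix \<pi> assume \<pi>: "\<pi> \<in> nc_pairings_on {a..<b}" and ak: "{a, k} \<in> \<pi>"
    have sep: "{a, k} \<inter> {a + 1..<k} = {}" "{a, k} \<inter> {k + 1..<b} = {}" "{a + 1..<k} \<inter> {k + 1..<b} = {}"
      and sub: "{a + 1..<k} \<subseteq> {a..<b}" "{k + 1..<b} \<subseteq> {a..<b}"
      using k by auto
    show "{\<beta> \<in> \<pi>. \<beta> \<subseteq> {a + 1..<k}} \<in> nc_pairings_on {a + 1..<k}"
    proof (rule nc_pairings_on_restrict[OF \<pi> sub(1)])
      fix \<beta> assume "\<beta> \<in> \<pi>" "\<beta> \<inter> {a + 1..<k} \<noteq> {}"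
      then show "\<beta> \<subseteq> {a + 1..<k}" using dichotomy[OF \<pi> ak, of \<beta>] sep by blast
    qed
    show "{\<beta> \<in> \<pi>. \<beta> \<subseteq> {k + 1..<b}} \<in> nc_pairings_on {k + 1..<b}"
    proof (rule nc_pairings_on_restrict[OF \<pi> sub(2)])
      fix \<beta> assume "\<beta> \<in> \<pi>" "\<beta> \<inter> {k + 1..<b} \<noteq> {}"
      then show "\<beta> \<subseteq> {k + 1..<b}" using dichotomy[OF \<pi> ak, of \<beta>] sep by blast
    qed
  qed
qed

definition nc_sum :: "(nat set \<Rightarrow> real) \<Rightarrow> nat set \<Rightarrow> real" where
  "nc_sum f A = (\<Sum>\<pi>\<in>nc_pairings_on A. \<Prod>\<beta>\<in>\<pi>. f \<beta>)"

text \<open>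
  Classify the pairings by the partner \<open>k\<close> of the first point.
\<close>
lemma nc_sum_rec:
  assumes "a < b"
  shows "nc_sum f {a..<b} = (\<Sum>k\<in>{a + 1..<b}. f {a, k} * (nc_sum f {a + 1..<k} * nc_sum f {k + 1..<b}))"
proof -
  let ?N = "\<lambda>k. {\<pi> \<in> nc_pairings_on {a..<b}. {a, k} \<in> \<pi>}"
  have "\<exists>k\<in>{a + 1..<b}. {a, k} \<in> \<pi>" if \<pi>: "\<pi> \<in> nc_pairings_on {a..<b}" for \<pi>
  proof -
    have "a \<in> \<Union>\<pi>" using nc_pairings_onD(1)[OF \<pi>] assms by simp
    then obtain \<beta> where \<beta>: "\<beta> \<in> \<pi>" "a \<in> \<beta>" by blast
    obtain p q where "p < q" "\<beta> = {p, q}" "p \<in> {a..<b}" "q \<in> {a..<b}"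
      using nc_pairings_on_block[OF \<pi> \<beta>(1)] .
    then show ?thesis using \<beta> by (intro bexI[of _ q]) auto
  qed
  then have cover: "nc_pairings_on {a..<b} = (\<Union>k\<in>{a + 1..<b}. ?N k)" by auto
  have disj: "?N k \<inter> ?N l = {}" if "k \<noteq> l" for k l
  proof -
    have "{a, k} \<noteq> {a, l}" using that by (auto simp: doubleton_eq_iff)
    then have "\<not> ({a, k} \<in> \<pi> \<and> {a, l} \<in> \<pi>)" if "\<pi> \<in> nc_pairings_on {a..<b}" for \<pi>
      using disjointD[OF nc_pairings_onD(3)[OF that], of "{a, k}" "{a, l}"] by blast
    then show ?thesis by blast
  qed
  have fin: "finite {a + 1..<b}" "finite (?N k)" for k
    by (simp_all add: nc_pairings_on_finite)
  have "nc_sum f {a..<b} = (\<Sum>k\<in>{a + 1..<b}. \<Sum>\<pi>\<in>?N k. \<Prod>\<beta>\<in>\<pi>. f \<beta>)"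
    unfolding nc_sum_def by (subst cover, rule sum.UNION_disjoint) (use disj fin in blast)+
  also have "\<dots> = (\<Sum>k\<in>{a + 1..<b}. f {a, k} * (nc_sum f {a + 1..<k} * nc_sum f {k + 1..<b}))"
  proof (rule sum.cong[OF refl])
    fix k assume "k \<in> {a + 1..<b}"
    then have k: "a < k" "k < b" by auto
    have prod: "(\<Prod>\<beta>\<in>insert {a, k} (\<pi>\<^sub>1 \<union> \<pi>\<^sub>2). f \<beta>) = f {a, k} * ((\<Prod>\<beta>\<in>\<pi>\<^sub>1. f \<beta>) * (\<Prod>\<beta>\<in>\<pi>\<^sub>2. f \<beta>))"
      if 1: "\<pi>\<^sub>1 \<in> nc_pairings_on {a + 1..<k}" and 2: "\<pi>\<^sub>2 \<in> nc_pairings_on {k + 1..<b}" for \<pi>\<^sub>1 \<pi>\<^sub>2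
    proof -
      note U = nc_pairings_onD(1)[OF 1] nc_pairings_onD(1)[OF 2] nc_pairings_onD(2)[OF 1]
      have "finite \<pi>\<^sub>1" "finite \<pi>\<^sub>2"
        using finite_UnionD[of \<pi>\<^sub>1] finite_UnionD[of \<pi>\<^sub>2] U by simp_all
      moreover have "{a, k} \<notin> \<pi>\<^sub>1 \<union> \<pi>\<^sub>2"
      proof
        assume "{a, k} \<in> \<pi>\<^sub>1 \<union> \<pi>\<^sub>2"
        then have "a \<in> {a + 1..<k} \<union> {k + 1..<b}" using U by blast
        then show False using k by auto
      qed
      moreover have "\<pi>\<^sub>1 \<inter> \<pi>\<^sub>2 = {}"
      proof (rule ccontr)
        assume "\<pi>\<^sub>1 \<inter> \<pi>\<^sub>2 \<noteq> {}"
        then obtain \<beta> where "\<beta> \<in> \<pi>\<^sub>1" "\<beta> \<in> \<pi>\<^sub>2" by blast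
        moreover obtain x where "x \<in> \<beta>" using U(3) \<open>\<beta> \<in> \<pi>\<^sub>1\<close> by (metis ex_in_conv)
        ultimately have "x \<in> {a + 1..<k}" "x \<in> {k + 1..<b}" using U by blast+
        then show False by simp
      qed
      ultimately show ?thesis by (simp add: prod.union_disjoint)
    qed
    have "(\<Sum>\<pi>\<in>?N k. \<Prod>\<beta>\<in>\<pi>. f \<beta>) =
      (\<Sum>x\<in>nc_pairings_on {a + 1..<k} \<times> nc_pairings_on {k + 1..<b}.
        \<Prod>\<beta>\<in>(case x of (\<pi>\<^sub>1, \<pi>\<^sub>2) \<Rightarrow> insert {a, k} (\<pi>\<^sub>1 \<union> \<pi>\<^sub>2)). f \<beta>)"
      by (rule sum.reindex_bij_betw[OF bij_betw_nc_pairings_join[OF k], symmetric])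
    also have "\<dots> = (\<Sum>(\<pi>\<^sub>1, \<pi>\<^sub>2)\<in>nc_pairings_on {a + 1..<k} \<times> nc_pairings_on {k + 1..<b}.
        f {a, k} * ((\<Prod>\<beta>\<in>\<pi>\<^sub>1. f \<beta>) * (\<Prod>\<beta>\<in>\<pi>\<^sub>2. f \<beta>)))"
      by (rule sum.cong[OF refl]) (auto simp del: Un_insert_left simp: prod)
    also have "\<dots> = f {a, k} * (nc_sum f {a + 1..<k} * nc_sum f {k + 1..<b})"
      by (simp only: nc_sum_def sum.cartesian_product[symmetric] sum_distrib_left[symmetric] sum_distrib_right[symmetric])
    finally show "(\<Sum>\<pi>\<in>?N k. \<Prod>\<beta>\<in>\<pi>. f \<beta>) = f {a, k} * (nc_sum f {a + 1..<k} * nc_sum f {k + 1..<b})" .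
  qed
  finally show ?thesis .
qed

lemma free_moment_eq_nc_sum:
  "free_moment c (map t [a..<b]) = nc_sum (\<lambda>\<beta>. c (t (Min \<beta>)) (t (Max \<beta>))) {a..<b}"
proof (induction "b - a" arbitrary: a b rule: less_induct)
  case less
  let ?f = "\<lambda>\<beta>. c (t (Min \<beta>)) (t (Max \<beta>))"
  show ?case
  proof (cases "a < b")
    case False
    then show ?thesis by (simp add: nc_sum_def nc_pairings_on_empty)
  next
    case True
    have "free_moment c (map t [a..<b]) = (\<Sum>m<b - (a + 1). c (t a) (t (a + 1 + m)) *
       (free_moment c (map t [a + 1..<a + 1 + m]) * free_moment c (map t [a + 1 + m + 1..<b])))"
    proof -
      have "map t [a..<b] = t a # map t [a + 1..<b]" using True by (simp add: upt_conv_Cons)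
      then show ?thesis
        by (simp only: free_moment.simps length_map length_upt)
           (intro sum.cong refl, auto simp only: lessThan_iff nth_map length_upt nth_upt take_map drop_map
             take_upt drop_upt less_diff_conv2 add.assoc Suc_eq_plus1)
    qed
    also have "\<dots> = (\<Sum>m<b - (a + 1). ?f {a, a + 1 + m} *
       (nc_sum ?f {a + 1..<a + 1 + m} * nc_sum ?f {a + 1 + m + 1..<b}))"
    proof (rule sum.cong[OF refl])
      fix m assume "m \<in> {..<b - (a + 1)}"
      then have "free_moment c (map t [a + 1..<a + 1 + m]) = nc_sum ?f {a + 1..<a + 1 + m}"
        "free_moment c (map t [a + 1 + m + 1..<b]) = nc_sum ?f {a + 1 + m + 1..<b}"
        by (intro less; simp)+
      then show "c (t a) (t (a + 1 + m)) *
       (free_moment c (map t [a + 1..<a + 1 + m]) * free_moment c (map t [a + 1 + m + 1..<b])) =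
       ?f {a, a + 1 + m} * (nc_sum ?f {a + 1..<a + 1 + m} * nc_sum ?f {a + 1 + m + 1..<b})"
        by simp
    qed
    also have "\<dots> = (\<Sum>k\<in>{a + 1..<b}. ?f {a, k} * (nc_sum ?f {a + 1..<k} * nc_sum ?f {k + 1..<b}))"
      by (rule sum.reindex_bij_witness[of _ "\<lambda>k. k - (a + 1)" "\<lambda>m. a + 1 + m"]) auto
    finally show ?thesis using nc_sum_rec[OF True] by simp
  qed
qed


section \<open>The matrix model of Hermitian fractional Brownian motion\<close>

context prob_space
begin

definition paths_combination ::
  "(nat \<times> nat) set \<Rightarrow> real set \<Rightarrow> (nat \<Rightarrow> nat \<Rightarrow> real \<Rightarrow> 'a \<Rightarrow> real) \<Rightarrow> (nat \<times> nat \<Rightarrow> real \<Rightarrow> real) \<Rightarrow> 'a \<Rightarrow> real" where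
  "paths_combination I T x a \<omega> = (\<Sum>p\<in>I. \<Sum>t\<in>T. a p t * x (fst p) (snd p) t \<omega>)"

lemma fbm_gaussian_moments:
  assumes "fractional_brownian_motion H Y" "finite T" "T \<subseteq> {0..}"
  shows "gaussian_moments (\<lambda>\<omega>. \<Sum>t\<in>T. a t * Y t \<omega>)"
proof (rule gaussian_imp_gaussian_moments)
  have g: "gaussian (\<lambda>\<omega>. \<Sum>t\<in>J. a t * Y t \<omega>)" if "finite J" "J \<subseteq> {0..}" for J a
    using assms(1) that unfolding fractional_brownian_motion_def gaussian_process_def by blast
  show "gaussian (\<lambda>\<omega>. \<Sum>t\<in>T. a t * Y t \<omega>)" using g assms by blast
  have mean: "expectation (Y t) = 0" if "t \<in> T" for t
    using assms that unfolding fractional_brownian_motion_def by auto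
  have "gaussian_moments (Y t)" if "t \<in> T" for t
    using g[of "{t}" "\<lambda>_. 1"] that assms mean[OF that] by (intro gaussian_imp_gaussian_moments) auto
  then have "integrable M (Y t)" if "t \<in> T" for t
    using that by (auto simp: gaussian_moments_def intro: all_moments_integrable)
  then show "expectation (\<lambda>\<omega>. \<Sum>t\<in>T. a t * Y t \<omega>) = 0"
    by (simp add: Bochner_Integration.integral_sum mean)
qed

lemma measurable_path_evaluation: "0 \<le> t \<Longrightarrow> (\<lambda>f. f t) \<in> borel_measurable path_space"
  by (rule measurable_component_singleton) simp

lemma measurable_family_evaluation:
  assumes "p \<in> lower_indices" "0 \<le> t"
  shows "(\<lambda>f. f p t) \<in> borel_measurable (PiM lower_indices (\<lambda>_. path_space))"
  using measurable_compose[OF measurable_component_singleton[OF assms(1)] measurable_path_evaluation[OF assms(2)]]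
  by simp

lemma gaussian_moments_paths_combination:
  assumes x: "independent_fbm_family H x" and I: "finite I" "I \<subseteq> lower_indices" and T: "finite T" "T \<subseteq> {0..}"
  shows "gaussian_moments (paths_combination I T x a)"
  unfolding paths_combination_def
proof (rule gaussian_moments_indep_sum[OF I(1)])
  have "indep_vars (\<lambda>_. path_space) (\<lambda>(i, j). sample_path (x i j)) I"
    by (rule indep_vars_subset[OF x[unfolded independent_fbm_family_def, THEN conjunct2] I(2)])
  then have "indep_vars (\<lambda>_. borel) (\<lambda>p \<omega>. \<Sum>t\<in>T. a p t * (case p of (i, j) \<Rightarrow> sample_path (x i j)) \<omega> t) I"
    by (rule indep_vars_compose2)
       (use T in \<open>auto intro!: borel_measurable_sum borel_measurable_times measurable_path_evaluation\<close>)
  moreover have "(\<Sum>t\<in>T. a p t * (case p of (i, j) \<Rightarrow> sample_path (x i j)) \<omega> t) =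
      (\<Sum>t\<in>T. a p t * x (fst p) (snd p) t \<omega>)" for p \<omega>
    using T by (intro sum.cong) (auto simp: sample_path_def split: prod.split)
  ultimately show "indep_vars (\<lambda>_. borel) (\<lambda>p \<omega>. \<Sum>t\<in>T. a p t * x (fst p) (snd p) t \<omega>) I"
    by (simp only:)
  show "gaussian_moments (\<lambda>\<omega>. \<Sum>t\<in>T. a p t * x (fst p) (snd p) t \<omega>)" if "p \<in> I" for p
    using x I(2) that unfolding independent_fbm_family_def
    by (intro fbm_gaussian_moments[OF _ T, of H]) (auto simp: split_beta)
qed

lemma indep_var_paths_combination:
  assumes "independent_families x x'" and I: "I \<subseteq> lower_indices" and T: "T \<subseteq> {0..}"
  shows "indep_var borel (paths_combination I T x a) borel (paths_combination I T x' b)"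
proof -
  let ?F = "\<lambda>a f. \<Sum>p\<in>I. \<Sum>t\<in>T. a p t * f p t"
  have F: "?F a \<in> borel_measurable (PiM lower_indices (\<lambda>_. path_space))" for a
    using I T by (intro borel_measurable_sum borel_measurable_times measurable_family_evaluation) auto
  have eq: "?F a \<circ> family_path y = paths_combination I T y a" for a and y :: "nat \<Rightarrow> nat \<Rightarrow> real \<Rightarrow> 'a \<Rightarrow> real"
  proof
    fix \<omega>
    show "(?F a \<circ> family_path y) \<omega> = paths_combination I T y a \<omega>"
      unfolding comp_def paths_combination_def
      using I T by (intro sum.cong refl) (auto simp: family_path_def sample_path_def)
  qed
  show ?thesis
    using indep_var_compose[OF assms(1)[unfolded independent_families_def] F[of a] F[of b]] unfolding eq .
qed

definition paths_span ::
  "(nat \<Rightarrow> nat \<Rightarrow> real \<Rightarrow> 'a \<Rightarrow> real) \<Rightarrow> (nat \<Rightarrow> nat \<Rightarrow> real \<Rightarrow> 'a \<Rightarrow> real) \<Rightarrow> (nat \<times> nat) set \<Rightarrow> real set \<Rightarrow> ('a \<Rightarrow> real) set" where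
  "paths_span x x' I T = {\<lambda>\<omega>. paths_combination I T x a \<omega> + paths_combination I T x' b \<omega> | a b. True}"

text \<open>
  Each process is Gaussian by itself; joint Gaussianity across processes and across the two families
  comes from independence.
\<close>
lemma gaussian_space_paths_span:
  assumes "independent_fbm_family H x" "independent_fbm_family H x'" "independent_families x x'"
    and I: "finite I" "I \<subseteq> lower_indices" and T: "finite T" "T \<subseteq> {0..}"
  shows "gaussian_space M (paths_span x x' I T)"
proof unfold_locales
  fix u v assume "u \<in> paths_span x x' I T" "v \<in> paths_span x x' I T"
  then obtain a b a' b' where
    "u = (\<lambda>\<omega>. paths_combination I T x a \<omega> + paths_combination I T x' b \<omega>)"
    "v = (\<lambda>\<omega>. paths_combination I T x a' \<omega> + paths_combination I T x' b' \<omega>)"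
    unfolding paths_span_def by blast
  then have "(\<lambda>\<omega>. u \<omega> + v \<omega>) = (\<lambda>\<omega>. paths_combination I T x (\<lambda>p t. a p t + a' p t) \<omega> +
      paths_combination I T x' (\<lambda>p t. b p t + b' p t) \<omega>)"
    by (auto simp: paths_combination_def distrib_right sum.distrib)
  then show "(\<lambda>\<omega>. u \<omega> + v \<omega>) \<in> paths_span x x' I T" unfolding paths_span_def by blast
next
  fix u s assume "u \<in> paths_span x x' I T"
  then obtain a b where
    "u = (\<lambda>\<omega>. paths_combination I T x a \<omega> + paths_combination I T x' b \<omega>)"
    unfolding paths_span_def by blast
  then have "(\<lambda>\<omega>. s * u \<omega>) = (\<lambda>\<omega>. paths_combination I T x (\<lambda>p t. s * a p t) \<omega> +
      paths_combination I T x' (\<lambda>p t. s * b p t) \<omega>)"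
    by (auto simp: paths_combination_def distrib_left sum_distrib_left mult.assoc)
  then show "(\<lambda>\<omega>. s * u \<omega>) \<in> paths_span x x' I T" unfolding paths_span_def by blast
next
  fix u assume "u \<in> paths_span x x' I T"
  then show "gaussian_moments u"
    unfolding paths_span_def using assms
    by (auto intro!: gaussian_moments_indep_add gaussian_moments_paths_combination indep_var_paths_combination)
qed

lemma paths_span_component:
  assumes I: "finite I" "p \<in> I" and T: "finite T" "t \<in> T"
  shows "(\<lambda>\<omega>. a * x (fst p) (snd p) t \<omega>) \<in> paths_span x x' I T"
    and "(\<lambda>\<omega>. a * x' (fst p) (snd p) t \<omega>) \<in> paths_span x x' I T"
proof -
  let ?c = "\<lambda>q s. if q = p then if s = t then a else 0 else 0"
  have c: "paths_combination I T y ?c \<omega> = a * y (fst p) (snd p) t \<omega>" for y \<omega>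
  proof -
    have "paths_combination I T y ?c \<omega> =
      (\<Sum>q\<in>I. if q = p then \<Sum>s\<in>T. if s = t then a * y (fst p) (snd p) t \<omega> else 0 else 0)"
      unfolding paths_combination_def by (intro sum.cong refl) (auto intro!: sum.cong)
    then show ?thesis using assms by simp
  qed
  have z: "paths_combination I T y (\<lambda>_ _. 0) \<omega> = 0" for y \<omega>
    by (simp add: paths_combination_def)
  have "(\<lambda>\<omega>. a * x (fst p) (snd p) t \<omega>) =
    (\<lambda>\<omega>. paths_combination I T x ?c \<omega> + paths_combination I T x' (\<lambda>_ _. 0) \<omega>)" by (simp add: c z)
  then show "(\<lambda>\<omega>. a * x (fst p) (snd p) t \<omega>) \<in> paths_span x x' I T" unfolding paths_span_def by blast
  have "(\<lambda>\<omega>. a * x' (fst p) (snd p) t \<omega>) =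
    (\<lambda>\<omega>. paths_combination I T x (\<lambda>_ _. 0) \<omega> + paths_combination I T x' ?c \<omega>)" by (simp add: c z)
  then show "(\<lambda>\<omega>. a * x' (fst p) (snd p) t \<omega>) \<in> paths_span x x' I T" unfolding paths_span_def by blast
qed

lemma fbm_family_all_moments:
  assumes "independent_fbm_family H x" "(i, j) \<in> lower_indices" "0 \<le> t"
  shows "all_moments (x i j t)"
  using fbm_gaussian_moments[of H "x i j" "{t}" "\<lambda>_. 1"] assms
  unfolding independent_fbm_family_def gaussian_moments_def by auto

lemma fbm_family_mean:
  assumes "independent_fbm_family H x" "(i, j) \<in> lower_indices" "0 \<le> t"
  shows "expectation (x i j t) = 0"
  using assms unfolding independent_fbm_family_def fractional_brownian_motion_def by auto

lemma fbm_family_covariance: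
  assumes x: "independent_fbm_family H x" and p: "(i, j) \<in> lower_indices" and q: "(k, l) \<in> lower_indices"
    and t: "0 \<le> s" "0 \<le> t"
  shows "expectation (\<lambda>\<omega>. x i j s \<omega> * x k l t \<omega>) = (if (i, j) = (k, l) then fbm_cov H s t else 0)"
proof (cases "(i, j) = (k, l)")
  case True
  have "fractional_brownian_motion H (x i j)" using x p unfolding independent_fbm_family_def by blast
  then show ?thesis using True t unfolding fractional_brownian_motion_def by auto
next
  case False
  let ?Y = "\<lambda>r \<omega>. (case r of (i, j) \<Rightarrow> sample_path (x i j)) \<omega> (if r = (i, j) then s else t)"
  have "indep_vars (\<lambda>_. path_space) (\<lambda>(i, j). sample_path (x i j)) {(i, j), (k, l)}"
    by (rule indep_vars_subset[OF x[unfolded independent_fbm_family_def, THEN conjunct2]]) (use p q in simp)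
  then have ind: "indep_vars (\<lambda>_. borel) ?Y {(i, j), (k, l)}"
    by (rule indep_vars_compose2) (use t in \<open>auto intro!: measurable_path_evaluation\<close>)
  have Y: "?Y (i, j) = x i j s" "?Y (k, l) = x k l t"
    using t False by (auto simp: sample_path_def)
  have "expectation (\<lambda>\<omega>. \<Prod>r\<in>{(i, j), (k, l)}. ?Y r \<omega>) = (\<Prod>r\<in>{(i, j), (k, l)}. expectation (?Y r))"
  proof (rule indep_vars_lebesgue_integral[OF _ ind])
    fix r assume "r \<in> {(i, j), (k, l)}"
    then have "?Y r = x i j s \<or> ?Y r = x k l t" using Y by blast
    then show "integrable M (?Y r)"
      using all_moments_integrable[OF fbm_family_all_moments[OF x p t(1)]]
        all_moments_integrable[OF fbm_family_all_moments[OF x q t(2)]] by metis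
  qed simp
  also have "\<dots> = expectation (?Y (i, j)) * expectation (?Y (k, l))"
    using False by (subst prod.insert) auto
  also have "\<dots> = 0" unfolding Y by (simp add: fbm_family_mean[OF x p t(1)])
  also have "expectation (\<lambda>\<omega>. \<Prod>r\<in>{(i, j), (k, l)}. ?Y r \<omega>) = expectation (\<lambda>\<omega>. ?Y (i, j) \<omega> * ?Y (k, l) \<omega>)"
    using False by (subst prod.insert) auto
  also have "\<dots> = expectation (\<lambda>\<omega>. x i j s \<omega> * x k l t \<omega>)"
    unfolding fun_cong[OF Y(1)] fun_cong[OF Y(2)] ..
  finally show ?thesis using False by auto
qed

lemma independent_families_covariance:
  assumes x: "independent_fbm_family H x" and x': "independent_fbm_family H x'"
    and xx': "independent_families x x'"
    and p: "(i, j) \<in> lower_indices" and q: "(k, l) \<in> lower_indices" and t: "0 \<le> s" "0 \<le> t"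
  shows "expectation (\<lambda>\<omega>. x i j s \<omega> * x' k l t \<omega>) = 0"
proof -
  have "indep_var borel ((\<lambda>f. f (i, j) s) \<circ> family_path x) borel ((\<lambda>f. f (k, l) t) \<circ> family_path x')"
    by (intro indep_var_compose[OF xx'[unfolded independent_families_def]] measurable_family_evaluation p q t)
  moreover have "(\<lambda>f. f (i, j) s) \<circ> family_path x = x i j s" "(\<lambda>f. f (k, l) t) \<circ> family_path x' = x' k l t"
    using p q t by (auto simp: family_path_def sample_path_def)
  ultimately have "indep_var borel (x i j s) borel (x' k l t)" by simp
  then have "expectation (\<lambda>\<omega>. x i j s \<omega> * x' k l t \<omega>) = expectation (x i j s) * expectation (x' k l t)"
    by (intro indep_var_lebesgue_integral all_moments_integrable
          fbm_family_all_moments[OF x p t(1)] fbm_family_all_moments[OF x' q t(2)])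
  then show ?thesis by (simp add: fbm_family_mean[OF x p t(1)])
qed

text \<open>
  The coefficients of \<open>x\<close> and of \<open>x'\<close> in the \<open>(i, j)\<close> entry. The entry
  uses the processes with indices \<open>max i j\<close>, \<open>min i j\<close>; the sign of the second
  coefficient above the diagonal accounts for the complex conjugation.
\<close>
definition re_weight :: "nat \<Rightarrow> nat \<Rightarrow> nat \<Rightarrow> real" where
  "re_weight d i j = (if i = j then 1 / sqrt d else 1 / sqrt (2 * d))"

definition im_weight :: "nat \<Rightarrow> nat \<Rightarrow> nat \<Rightarrow> real" where
  "im_weight d i j = (if i = j then 0 else if j < i then 1 / sqrt (2 * d) else - 1 / sqrt (2 * d))"

lemma hermitian_fbm_entry:
  assumes "i < d" "j < d"
  shows "hermitian_fbm x x' d t \<omega> $$ (i, j) =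
    of_real (re_weight d i j * x (max i j) (min i j) t \<omega>) + \<i> * of_real (im_weight d i j * x' (max i j) (min i j) t \<omega>)"
  using assms
  by (cases i j rule: linorder_cases)
     (auto simp: hermitian_fbm_def re_weight_def im_weight_def max_def min_def Let_def algebra_simps)

text \<open>
  For an off-diagonal entry, \<open>1/(2d) - 1/(2d) = 0\<close> with itself and \<open>1/(2d) + 1/(2d) = 1/d\<close> with the
  transposed entry: this is how the real and imaginary parts produce the covariance of the matrix model.
\<close>
lemma weights_covariance:
  assumes "0 < d" "(max i j, min i j) = (max k l, min k l)"
  shows "re_weight d i j * re_weight d k l - im_weight d i j * im_weight d k l =
    (if i = l \<and> j = k then 1 / d else 0)"
proof -
  have "(1 / sqrt d) * (1 / sqrt d) = 1 / d" "(1 / sqrt (2 * d)) * (1 / sqrt (2 * d)) = 1 / (2 * d)"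
    by simp_all
  moreover have "(i = k \<and> j = l) \<or> (i = l \<and> j = k)"
    using assms(2) by (auto simp: max_def min_def split: if_splits)
  ultimately show ?thesis
    by (auto simp: re_weight_def im_weight_def)
qed

lemma hermitian_gaussian_matrices_fbm:
  assumes x: "independent_fbm_family H x" and x': "independent_fbm_family H x'" and xx': "independent_families x x'"
    and T: "finite T" "T \<subseteq> {0..}" and d: "0 < d"
  shows "hermitian_gaussian_matrices M (paths_span x x' {(i, j). j \<le> i \<and> i < d} T) d T (fbm_cov H)
    (\<lambda>t i j \<omega>. hermitian_fbm x x' d t \<omega> $$ (i, j))"
proof -
  let ?I = "{(i, j). j \<le> i \<and> i < d}"
  have I: "finite ?I" "?I \<subseteq> lower_indices"
    by (rule finite_subset[of _ "{..<d} \<times> {..<d}"]) (auto simp: lower_indices_def)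
  interpret gaussian_space M "paths_span x x' ?I T"
    by (rule gaussian_space_paths_span[OF x x' xx' I T])
  show ?thesis
  proof (unfold_locales)
    show "0 < d" by (rule d)
  next
    fix t i j assume t: "t \<in> T" and ij: "i < d" "j < d"
    let ?p = "(max i j, min i j)"
    have "?p \<in> ?I" using ij by auto
    note span = paths_span_component[OF I(1) this T(1) t, unfolded fst_conv snd_conv]
    show "(\<lambda>\<omega>. hermitian_fbm x x' d t \<omega> $$ (i, j)) \<in> complexification"
      unfolding complexification_def hermitian_fbm_entry[OF ij]
      by (rule CollectI, rule bexI[OF _ span(1)], rule bexI[OF _ span(2)], rule refl)
  next
    fix s t i j k l assume s: "s \<in> T" and t: "t \<in> T" and ij: "i < d" "j < d" and kl: "k < d" "l < d"
    let ?p = "(max i j, min i j)" and ?q = "(max k l, min k l)"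
    have p: "?p \<in> lower_indices" and q: "?q \<in> lower_indices" by (auto simp: lower_indices_def)
    have st: "0 \<le> s" "0 \<le> t" using s t T by auto
    let ?x = "x (max i j) (min i j) s" and ?y = "x (max k l) (min k l) t"
    let ?x' = "x' (max i j) (min i j) s" and ?y' = "x' (max k l) (min k l) t"
    let ?a = "re_weight d i j" and ?b = "im_weight d i j" and ?a' = "re_weight d k l" and ?b' = "im_weight d k l"
    note mom = fbm_family_all_moments[OF x p st(1)] fbm_family_all_moments[OF x q st(2)]
      fbm_family_all_moments[OF x' p st(1)] fbm_family_all_moments[OF x' q st(2)]
    have int: "integrable M (\<lambda>\<omega>. ?x \<omega> * ?y \<omega>)" "integrable M (\<lambda>\<omega>. ?x' \<omega> * ?y' \<omega>)"
      "integrable M (\<lambda>\<omega>. ?x \<omega> * ?y' \<omega>)" "integrable M (\<lambda>\<omega>. ?y \<omega> * ?x' \<omega>)"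
      by (intro all_moments_integrable all_moments_mult mom)+
    have re: "expectation (\<lambda>\<omega>. ?a * ?a' * (?x \<omega> * ?y \<omega>) - ?b * ?b' * (?x' \<omega> * ?y' \<omega>)) =
      (if i = l \<and> j = k then fbm_cov H s t / d else 0)"
    proof -
      have "expectation (\<lambda>\<omega>. ?a * ?a' * (?x \<omega> * ?y \<omega>) - ?b * ?b' * (?x' \<omega> * ?y' \<omega>)) =
        (?a * ?a' - ?b * ?b') * (if ?p = ?q then fbm_cov H s t else 0)"
        using int fbm_family_covariance[OF x p q st] fbm_family_covariance[OF x' p q st]
        by (simp add: left_diff_distrib)
      then show ?thesis
        using weights_covariance[OF d, of i j k l] by (cases "?p = ?q") (auto simp: max.commute min.commute)
    qed
    have im: "expectation (\<lambda>\<omega>. ?a * ?b' * (?x \<omega> * ?y' \<omega>) + ?b * ?a' * (?y \<omega> * ?x' \<omega>)) = 0"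
      using int independent_families_covariance[OF x x' xx' p q st]
        independent_families_covariance[OF x x' xx' q p st(2,1)]
      by simp
    have "expectation (\<lambda>\<omega>. hermitian_fbm x x' d s \<omega> $$ (i, j) * hermitian_fbm x x' d t \<omega> $$ (k, l)) =
      expectation (\<lambda>\<omega>. complex_of_real (?a * ?a' * (?x \<omega> * ?y \<omega>) - ?b * ?b' * (?x' \<omega> * ?y' \<omega>)) +
        \<i> * complex_of_real (?a * ?b' * (?x \<omega> * ?y' \<omega>) + ?b * ?a' * (?y \<omega> * ?x' \<omega>)))"
      unfolding hermitian_fbm_entry[OF ij] hermitian_fbm_entry[OF kl]
      by (intro Bochner_Integration.integral_cong refl) (simp add: algebra_simps)
    also have "\<dots> = expectation (\<lambda>\<omega>. complex_of_real (?a * ?a' * (?x \<omega> * ?y \<omega>) - ?b * ?b' * (?x' \<omega> * ?y' \<omega>))) +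
        expectation (\<lambda>\<omega>. \<i> * complex_of_real (?a * ?b' * (?x \<omega> * ?y' \<omega>) + ?b * ?a' * (?y \<omega> * ?x' \<omega>)))"
      by (intro Bochner_Integration.integral_add integrable_mult_right integrable_of_real
          Bochner_Integration.integrable_add Bochner_Integration.integrable_diff int)
    also have "\<dots> = complex_of_real (if i = l \<and> j = k then fbm_cov H s t / d else 0) + \<i> * complex_of_real 0"
      by (simp only: integral_complex_of_real integral_mult_right_zero re im)
    finally show "expectation (\<lambda>\<omega>. hermitian_fbm x x' d s \<omega> $$ (i, j) * hermitian_fbm x x' d t \<omega> $$ (k, l)) =
      (if i = l \<and> j = k then complex_of_real (fbm_cov H s t) / of_nat d else 0)"
      by simp
  qed
qed

end


section \<open>Convergence to non-commutative fractional Brownian motion\<close>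

theorem proposition3p6:
  fixes H :: real
    and M :: "'w measure"
    and x x' :: "nat \<Rightarrow> nat \<Rightarrow> real \<Rightarrow> 'w \<Rightarrow> real"
    and scale :: "complex \<Rightarrow> 'a :: ring_1 \<Rightarrow> 'a"
    and star :: "'a \<Rightarrow> 'a"
    and \<phi> :: "'a \<Rightarrow> complex"
    and X :: "real \<Rightarrow> 'a"
  assumes "0 < H" and "H < 1"
    and "prob_space M"
    and "prob_space.independent_fbm_family M H x"
    and "prob_space.independent_fbm_family M H x'"
    and "prob_space.independent_families M x x'"
    and "nc_probability_space scale star \<phi>"
    and "nc_fractional_brownian_motion star \<phi> H X"
  shows "\<forall>r\<ge>1. \<forall>t :: nat \<Rightarrow> real. (\<forall>k\<in>{1..r}. 0 \<le> t k) \<longrightarrow>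
    (\<lambda>d. prob_space.mean_trace M d
           (\<lambda>\<omega>. mat_prod_list d (map (\<lambda>k. hermitian_fbm x x' d (t k) \<omega>) [1..<r + 1])))
      \<longlonglongrightarrow> \<phi> (prod_list (map (\<lambda>k. X (t k)) [1..<r + 1]))"
proof (intro allI impI)
  fix r :: nat and t :: "nat \<Rightarrow> real"
  assume r: "1 \<le> r" and t: "\<forall>k\<in>{1..r}. 0 \<le> t k"
  interpret prob_space M by fact
  let ?T = "t ` {1..r}"
  let ?w = "map t [1..<r + 1]"
  let ?X = "\<lambda>d t i j \<omega>. hermitian_fbm x x' d t \<omega> $$ (i, j)"
  have T: "finite ?T" "?T \<subseteq> {0..}" using t by auto
  have w: "set ?w \<subseteq> ?T" by auto
  have model: "hermitian_gaussian_matrices M (paths_span x x' {(i, j). j \<le> i \<and> i < d} ?T) d ?T (fbm_cov H) (?X d)"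
    if "0 < d" for d
    using assms(4-6) T that by (rule hermitian_gaussian_matrices_fbm)
  have lim: "(\<lambda>d. hermitian_gaussian_matrices.normalized_moment M d (?X d) [?w]) \<longlonglongrightarrow> of_real (free_moment (fbm_cov H) ?w)"
    using model w by (rule tendsto_normalized_moment)
  have ev: "eventually (\<lambda>d. hermitian_gaussian_matrices.normalized_moment M d (?X d) [?w] =
      mean_trace d (\<lambda>\<omega>. mat_prod_list d (map (\<lambda>k. hermitian_fbm x x' d (t k) \<omega>) [1..<r + 1]))) sequentially"
    using eventually_gt_at_top[of 0]
  proof eventually_elim
    case (elim d)
    have "hermitian_fbm x x' d s \<omega> \<in> carrier_mat d d" for s \<omega>
      by (simp add: hermitian_fbm_def Let_def)
    from hermitian_gaussian_matrices.mean_trace_eq_normalized_moment[OF model[OF elim], of "hermitian_fbm x x' d", OF this refl, of ?w]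
    show ?case by (simp add: comp_def)
  qed
  have eq: "complex_of_real (free_moment (fbm_cov H) ?w) = \<phi> (prod_list (map (\<lambda>k. X (t k)) [1..<r + 1]))"
  proof -
    have \<phi>: "\<phi> (prod_list (map (\<lambda>k. X (t k)) [1..<r + 1])) = (if even r
           then complex_of_real (\<Sum>\<pi>\<in>noncrossing_pairings r. \<Prod>b\<in>\<pi>. fbm_cov H (t (Min b)) (t (Max b))) else 0)"
      using assms(8) r t unfolding nc_fractional_brownian_motion_def by blast
    have "free_moment (fbm_cov H) ?w =
      (\<Sum>\<pi>\<in>noncrossing_pairings r. \<Prod>b\<in>\<pi>. fbm_cov H (t (Min b)) (t (Max b)))"
      by (simp only: free_moment_eq_nc_sum nc_sum_def noncrossing_pairings_eq)
    moreover have "noncrossing_pairings r = {}" if "odd r"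
      unfolding noncrossing_pairings_eq using that by (intro nc_pairings_on_odd) simp_all
    ultimately show ?thesis unfolding \<phi> by simp
  qed
  show "(\<lambda>d. mean_trace d (\<lambda>\<omega>. mat_prod_list d (map (\<lambda>k. hermitian_fbm x x' d (t k) \<omega>) [1..<r + 1])))
      \<longlonglongrightarrow> \<phi> (prod_list (map (\<lambda>k. X (t k)) [1..<r + 1]))"
    by (rule Lim_transform_eventually[OF lim ev, unfolded eq])
qed

end
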